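(* Let $K$ be an algebraically closed field of characteristic zero, $R=K[x_1,\dots,x_n]$, and $S=K[X_1,\dots,X_n]$ the divided power algebra viewed as an $R$-module via contraction. Let $F\in S$ be a homogeneous binomial (a sum of two monomials with nonzero coefficients) such that $A_F=R/\operatorname{Ann}_R(F)$ is an Artinian complete intersection $K$-algebra of codimension $n$. Then $A_F$ satisfies the strong Lefschetz property.
   Context: The contraction action is $x_i\circ X_j^k=\delta_{ij}X_j^{k-1}$ if $k>0$ and $0$ otherwise, extended linearly; $\operatorname{Ann}_R(F)=\{f\in R\mid f\circ F=0\}$ and $F$ is called the Macaulay dual generator of $A_F$. A graded Artinian $K$-algebra $A$ has the strong Lefschetz property if there is a linear form $\ell\in A_1$ such that for all integers $i\ge 0$ and $k\ge 1$ the multiplication map $\times\ell^k:A_i\to A_{i+k}$ has maximal rank (is injective or surjective). *)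

theory Defs
  imports "HOL-Library.Poly_Mapping" "HOL-Computational_Algebra.Polynomial"
begin

text \<open>Polynomials in the variables x_0, x_1, ... over 'a: finitely supported maps from
 exponent vectors (nat =>0 nat) to coefficients.  The same carrier is used for
 the divided power algebra S (elements X^b written as the exponent vector b);
 only the R-module structure of S (contraction) matters.\<close>

type_synonym 'a mpoly = "(nat \<Rightarrow>\<^sub>0 nat) \<Rightarrow>\<^sub>0 'a"

definition mdeg :: "(nat \<Rightarrow>\<^sub>0 nat) \<Rightarrow> nat" where
  "mdeg a = (\<Sum>i\<in>Poly_Mapping.keys a. Poly_Mapping.lookup a i)"

definition in_vars :: "nat \<Rightarrow> 'a::zero mpoly \<Rightarrow> bool" where
  "in_vars n f \<longleftrightarrow> (\<forall>a\<in>Poly_Mapping.keys f. Poly_Mapping.keys a \<subseteq> {..<n})"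

definition homog :: "nat \<Rightarrow> 'a::zero mpoly \<Rightarrow> bool" where
  "homog d f \<longleftrightarrow> (\<forall>a\<in>Poly_Mapping.keys f. mdeg a = d)"

text \<open>Contraction: x^a \<circ> X^b = X^(b-a) if a \<le> b componentwise, 0 otherwise, extended
 bilinearly. The coefficient of X^c in f \<circ> F is sum over a of f_a * F_(a+c).\<close>
definition contract :: "'a::comm_ring_1 mpoly \<Rightarrow> 'a mpoly \<Rightarrow> 'a mpoly" where
  "contract f F = Abs_poly_mapping (\<lambda>c. \<Sum>a\<in>Poly_Mapping.keys f. Poly_Mapping.lookup f a * Poly_Mapping.lookup F (a + c))"

definition Ann :: "nat \<Rightarrow> 'a::comm_ring_1 mpoly \<Rightarrow> 'a mpoly set" where
  "Ann n F = {f. in_vars n f \<and> contract f F = 0}"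

definition homog_binomial :: "nat \<Rightarrow> 'a::comm_ring_1 mpoly \<Rightarrow> bool" where
  "homog_binomial n F \<longleftrightarrow> (\<exists>a b c1 c2. a \<noteq> b \<and> c1 \<noteq> 0 \<and> c2 \<noteq> 0 \<and>
     Poly_Mapping.keys a \<subseteq> {..<n} \<and> Poly_Mapping.keys b \<subseteq> {..<n} \<and> mdeg a = mdeg b \<and>
     F = Poly_Mapping.single a c1 + Poly_Mapping.single b c2)"

definition gen_ideal :: "nat \<Rightarrow> nat \<Rightarrow> (nat \<Rightarrow> 'a::comm_ring_1 mpoly) \<Rightarrow> 'a mpoly set" where
  "gen_ideal n m g = {\<Sum>i<m. h i * g i | h. \<forall>i<m. in_vars n (h i)}"

text \<open>R/I is Artinian: finite-dimensional, i.e. spanned modulo I by finitely many elements.\<close>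
definition artinian_quot :: "nat \<Rightarrow> 'a::field mpoly set \<Rightarrow> bool" where
  "artinian_quot n I \<longleftrightarrow> (\<exists>B. finite B \<and> B \<subseteq> {f. in_vars n f} \<and>
     (\<forall>f. in_vars n f \<longrightarrow> (\<exists>c. f - (\<Sum>b\<in>B. Poly_Mapping.single 0 (c b) * b) \<in> I)))"

definition artinian_CI :: "nat \<Rightarrow> 'a::field mpoly set \<Rightarrow> bool" where
  "artinian_CI n I \<longleftrightarrow> artinian_quot n I \<and>
     (\<exists>g. (\<forall>i<n. in_vars n (g i)) \<and> I = gen_ideal n n g)"

text \<open>Strong Lefschetz property of the graded algebra R/I (I homogeneous), with
 A_i = R_i / I_i: some linear form L such that every map
 (times L^k): A_i \<rightarrow> A_(i+k) is injective or surjective.\<close>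
definition SLP :: "nat \<Rightarrow> 'a::field mpoly set \<Rightarrow> bool" where
  "SLP n I \<longleftrightarrow> (\<exists>L. in_vars n L \<and> homog 1 L \<and>
     (\<forall>i k. k \<ge> 1 \<longrightarrow>
        ((\<forall>f. in_vars n f \<and> homog i f \<and> L ^ k * f \<in> I \<longrightarrow> f \<in> I) \<or>
         (\<forall>g. in_vars n g \<and> homog (i + k) g \<longrightarrow>
             (\<exists>f. in_vars n f \<and> homog i f \<and> g - L ^ k * f \<in> I)))))"

end

theory Submission
  imports Defs "Jordan_Normal_Form.Determinant"
begin


text \<open>
  Write \<open>F = c1 X\<^sup>a + c2 X\<^sup>b\<close> and \<open>\<Phi> f = c1 f\<^sub>a + c2 f\<^sub>b\<close>; the annihilator is the radical of the pairing
  \<open>\<Phi> (f * g)\<close>, so the strong Lefschetz property reduces to injectivity of \<open>L ^ (d - 2 * i)\<close> in degree \<open>i\<close>.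
  Counting minimal generators, a complete intersection forces one of the sets \<open>{a > b}\<close>, \<open>{b > a}\<close>, say
  \<open>{a > b}\<close>, to be a single variable \<open>i0\<close>, and moreover one of the following.
  If \<open>{b > a}\<close> has at least two elements, some annihilator element has leading term a power of \<open>i0\<close>
  with exponent \<open>b\<^sub>i\<^sub>0 + 1\<close>. The monomials dividing \<open>X\<^sup>b\<close> then span the quotient, and rescaling \<open>i0\<close>
  degenerates the pairing to that of the monomial \<open>X\<^sup>b\<close>, which is settled by \<open>sl\<^sub>2\<close> representation theory.
  If \<open>{b > a}\<close> is a single variable too, the quotient is the tensor product of a binary algebra with
  a monomial one. A Wronskian argument gives the binary algebra the property for a general
  linear form, and its decomposition into primitive strings reduces the product to the monomial case.
\<close>

text \<open>An annihilator element is a minimal generator once it involves an exponent none of whose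
  proper divisors occurs in any annihilator element. If \<open>n + 1\<close> such elements have an
  invertible coefficient matrix at these exponents, \<open>n\<close> generators cannot suffice. The
  exponent \<open>b\<^sub>i\<^sub>0 + 1\<close> is the first for which a power of \<open>i0\<close>
  no longer divides \<open>X\<^sup>b\<close>. It still meets \<open>X\<^sup>a\<close>, and that
  contribution is cancelled by moving along \<open>b - a\<close> until the exponent leaves
  \<open>a\<close>. If the power of \<open>i0\<close> is exhausted before that, a variable of
  \<open>{b > a}\<close> must be multiplied in, and two choices of it give one generator too many.
  If there is only one such variable, no contradiction arises and the divisors of
  \<open>X\<^sup>b\<close> need not span, which is why that case needs its own argument. In both
  cases the linear form depends on a parameter that only has to avoid a finite set. Characteristic
  zero supplies enough parameters, the nonzero \<open>sl\<^sub>2\<close> scalars and the degree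
  comparison for Wronskians.\<close>

hide_const (open) Module.smult

abbreviation lookup where "lookup \<equiv> Poly_Mapping.lookup"
abbreviation keys where "keys \<equiv> Poly_Mapping.keys"
abbreviation single where "single \<equiv> Poly_Mapping.single"
abbreviation xp :: "(nat \<Rightarrow>\<^sub>0 nat) \<Rightarrow> 'a::comm_ring_1 mpoly" where "xp p \<equiv> single p 1"

text \<open>The library order \<open>\<le>\<close> on \<open>nat \<Rightarrow>\<^sub>0 nat\<close> is lexicographic, hence a separate divisibility relation.\<close>

definition mdvd :: "(nat \<Rightarrow>\<^sub>0 nat) \<Rightarrow> (nat \<Rightarrow>\<^sub>0 nat) \<Rightarrow> bool" (infix "\<preceq>" 50) where
  "p \<preceq> q \<longleftrightarrow> (\<forall>i. lookup p i \<le> lookup q i)"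

subsection \<open>Exponent vectors\<close>

lemma mdvd_add_diff: "p \<preceq> q \<Longrightarrow> q - p + p = q"
  by (rule poly_mapping_eqI) (simp add: mdvd_def lookup_add lookup_minus)

lemma mdvd_iff_add: "p \<preceq> q \<longleftrightarrow> (\<exists>r. q = r + p)"
  by (metis mdvd_add_diff mdvd_def lookup_add le_add2)

lemma mdvd_keys: "p \<preceq> q \<Longrightarrow> keys p \<subseteq> keys q"
  unfolding mdvd_def subset_iff in_keys_iff by (metis le_zero_eq)

lemma mdeg_eq_sum: "finite N \<Longrightarrow> keys p \<subseteq> N \<Longrightarrow> mdeg p = (\<Sum>i\<in>N. lookup p i)"
  unfolding mdeg_def by (rule sum.mono_neutral_left) (auto simp: in_keys_iff)

lemma mdeg_add: "mdeg (p + q) = mdeg p + mdeg q"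
proof -
  let ?N = "keys p \<union> keys q"
  have "keys (p + q) \<subseteq> ?N" by (auto simp: in_keys_iff lookup_add)
  then show ?thesis
    by (simp add: mdeg_eq_sum[of ?N] lookup_add sum.distrib)
qed

lemma mdeg_single [simp]: "mdeg (single i k) = k"
  by (cases "k = 0") (auto simp: mdeg_def)

lemma mdeg_zero [simp]: "mdeg 0 = 0"
  by (simp add: mdeg_def)

lemma mdvd_mdeg: "p \<preceq> q \<Longrightarrow> mdeg p \<le> mdeg q"
  by (metis mdvd_iff_add mdeg_add le_add2)

lemma mdvd_mdeg_eq: "p \<preceq> q \<Longrightarrow> mdeg p = mdeg q \<Longrightarrow> p = q"
proof -
  assume a: "p \<preceq> q" "mdeg p = mdeg q"
  then obtain r where r: "q = r + p" by (auto simp: mdvd_iff_add)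
  then have "mdeg r = 0" using a by (simp add: mdeg_add)
  then have "r = 0" unfolding mdeg_def by (intro poly_mapping_eqI) (auto simp: in_keys_iff)
  with r show ?thesis by simp
qed

lemma finite_mdvd: "finite {p. p \<preceq> q}"
proof (rule finite_imageD[where f = "\<lambda>p. restrict (lookup p) (keys q)"])
  have "(\<lambda>p. restrict (lookup p) (keys q)) ` {p. p \<preceq> q} \<subseteq> (\<Pi>\<^sub>E i\<in>keys q. {..lookup q i})"
    by (auto simp: mdvd_def)
  then show "finite ((\<lambda>p. restrict (lookup p) (keys q)) ` {p. p \<preceq> q})"
    by (rule finite_subset) (intro finite_PiE, auto)
  show "inj_on (\<lambda>p. restrict (lookup p) (keys q)) {p. p \<preceq> q}"
  proof (rule inj_onI, rule poly_mapping_eqI)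
    fix p r i assume h: "p \<in> {p. p \<preceq> q}" "r \<in> {p. p \<preceq> q}"
      "restrict (lookup p) (keys q) = restrict (lookup r) (keys q)"
    show "lookup p i = lookup r i"
    proof (cases "i \<in> keys q")
      case True then show ?thesis using fun_cong[OF h(3), of i] by simp
    next
      case False
      then have "lookup q i = 0" by (simp add: in_keys_iff)
      then show ?thesis using h by (auto simp: mdvd_def) (metis le_zero_eq)
    qed
  qed
qed

lemma finite_mdeg_vars: "finite {p. keys p \<subseteq> {..<n} \<and> mdeg p = k}"
proof (rule finite_subset[OF _ finite_mdvd[of "\<Sum>i<n. single i k"]])
  have "lookup p i \<le> lookup (\<Sum>i<n. single i (mdeg p)) i" if "keys p \<subseteq> {..<n}" for p i
  proof (cases "i \<in> keys p")
    case True
    then have "lookup p i \<le> mdeg p" unfolding mdeg_def by (intro member_le_sum) auto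
    also have "\<dots> = (\<Sum>j<n. if j = i then mdeg p else 0)" using True that by auto
    also have "\<dots> = lookup (\<Sum>i<n. single i (mdeg p)) i"
      unfolding lookup_sum by (rule sum.cong) (auto simp: lookup_single when_def)
    finally show ?thesis .
  qed (simp add: in_keys_iff)
  then show "{p. keys p \<subseteq> {..<n} \<and> mdeg p = k} \<subseteq> {p. p \<preceq> (\<Sum>i<n. single i k)}"
    by (auto simp: mdvd_def)
qed

subsection \<open>Polynomials\<close>

lemma mpoly_eq_sum: "f = (\<Sum>p\<in>keys f. single p (lookup f p))"
  by (rule poly_mapping_eqI)
    (auto simp: lookup_sum lookup_single when_def in_keys_iff sum.delta)

lemma mpoly_eq_sum_xp: "f = (\<Sum>p\<in>keys f. single 0 (lookup f p) * xp p)"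
  by (subst mpoly_eq_sum) (simp add: mult_single)

lemma lookup_mult_xp_add: "lookup (f * xp q) (p + q) = lookup f p"
proof -
  have "lookup (f * xp q) (p + q) = (\<Sum>r\<in>keys f. lookup f r when r = p)"
    by (subst mpoly_eq_sum[of f])
      (auto simp: sum_distrib_right mult_single lookup_sum lookup_single when_def intro!: sum.cong)
  also have "\<dots> = lookup f p"
    by (auto simp: when_def in_keys_iff)
  finally show ?thesis .
qed

lemma lookup_mult_xp_not_mdvd: "\<not> q \<preceq> p \<Longrightarrow> lookup (f * xp q) p = 0"
  by (subst mpoly_eq_sum[of f])
    (auto simp: sum_distrib_right mult_single lookup_sum lookup_single when_def mdvd_iff_add
      intro!: sum.neutral)

lemma lookup_mult_xp: "lookup (f * xp q) p = (if q \<preceq> p then lookup f (p - q) else 0)"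
  using lookup_mult_xp_add[of f q "p - q"] lookup_mult_xp_not_mdvd[of q p f] mdvd_add_diff[of q p]
  by auto

lemma lookup_smult: "lookup (single 0 c * f) p = c * lookup f p"
  by (subst mpoly_eq_sum[of f], subst (2) mpoly_eq_sum[of f])
    (auto simp: sum_distrib_left mult_single lookup_sum lookup_single when_def intro!: sum.cong)

lemma lookup_mult_sum:
  "lookup (f * (g::'a::comm_ring_1 mpoly)) p = (\<Sum>q\<in>keys g. lookup g q * (if q \<preceq> p then lookup f (p - q) else 0))"
proof -
  have "f * g = (\<Sum>q\<in>keys g. single 0 (lookup g q) * (f * xp q))"
    by (subst mpoly_eq_sum_xp[of g]) (simp add: sum_distrib_left ac_simps)
  then show ?thesis by (simp add: lookup_sum lookup_smult lookup_mult_xp)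
qed

lemma in_varsI: "(\<And>p. lookup f p \<noteq> 0 \<Longrightarrow> keys p \<subseteq> {..<n}) \<Longrightarrow> in_vars n f"
  by (simp add: in_vars_def in_keys_iff)

lemma in_varsD: "in_vars n f \<Longrightarrow> lookup f p \<noteq> 0 \<Longrightarrow> keys p \<subseteq> {..<n}"
  by (simp add: in_vars_def in_keys_iff)

lemma homogI: "(\<And>p. lookup f p \<noteq> 0 \<Longrightarrow> mdeg p = k) \<Longrightarrow> homog k f"
  by (simp add: homog_def in_keys_iff)

lemma homogD: "homog k f \<Longrightarrow> lookup f p \<noteq> 0 \<Longrightarrow> mdeg p = k"
  by (simp add: homog_def in_keys_iff)

lemma in_vars_add: "in_vars n f \<Longrightarrow> in_vars n g \<Longrightarrow> in_vars n (f + g)"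
  using keys_add[of f g] by (auto simp: in_vars_def)

lemma in_vars_minus: "in_vars n f \<Longrightarrow> in_vars n g \<Longrightarrow> in_vars n (f - (g::'a::ab_group_add mpoly))"
  by (rule in_varsI) (metis in_varsD lookup_minus diff_self)

lemma in_vars_zero [simp]: "in_vars n 0"
  by (simp add: in_vars_def)

lemma in_vars_single: "keys p \<subseteq> {..<n} \<Longrightarrow> in_vars n (single p c)"
  by (simp add: in_vars_def)

lemma in_vars_const [simp]: "in_vars n (single 0 c)"
  by (simp add: in_vars_def)

lemma in_vars_sum: "(\<And>i. i \<in> I \<Longrightarrow> in_vars n (f i)) \<Longrightarrow> in_vars n (sum f I)"
  by (induction I rule: infinite_finite_induct) (auto intro: in_vars_add)

lemma in_vars_mult: "in_vars n f \<Longrightarrow> in_vars n g \<Longrightarrow> in_vars n (f * g)"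
proof -
  assume h: "in_vars n f" "in_vars n g"
  have "keys p \<subseteq> {..<n}" if pk: "p \<in> keys (f * g)" for p
  proof -
    obtain q r where qr: "p = q + r" "q \<in> keys f" "r \<in> keys g" using pk keys_mult[of f g] by blast
    moreover have "keys (q + r) \<subseteq> keys q \<union> keys r" by (rule keys_add)
    ultimately show ?thesis using h by (auto simp: in_vars_def)
  qed
  then show ?thesis by (simp add: in_vars_def)
qed

lemma in_vars_power: "in_vars n (f :: 'a::comm_ring_1 mpoly) \<Longrightarrow> in_vars n (f ^ k)"
  by (induction k) (auto intro: in_vars_mult simp: in_vars_def[of _ 1])

lemma homog_add: "homog k f \<Longrightarrow> homog k g \<Longrightarrow> homog k (f + g)"
  using keys_add[of f g] by (auto simp: homog_def)

lemma homog_minus: "homog k f \<Longrightarrow> homog k g \<Longrightarrow> homog k (f - (g::'a::ab_group_add mpoly))"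
  by (rule homogI) (metis homogD lookup_minus diff_self)

lemma homog_zero [simp]: "homog k 0"
  by (simp add: homog_def)

lemma homog_single: "mdeg p = k \<Longrightarrow> homog k (single p c)"
  by (simp add: homog_def)

lemma homog_sum: "(\<And>i. i \<in> I \<Longrightarrow> homog k (f i)) \<Longrightarrow> homog k (sum f I)"
  by (induction I rule: infinite_finite_induct) (auto intro: homog_add)

lemma homog_mult: "homog k f \<Longrightarrow> homog l g \<Longrightarrow> homog (k + l) (f * g)"
  using keys_mult[of f g] by (fastforce simp: homog_def mdeg_add)

lemma homog_smult: "homog k f \<Longrightarrow> homog k (single 0 c * f)"
  using homog_mult[of 0 "single 0 c" k f] by (simp add: homog_single)

lemma homog_power: "homog k (f :: 'a::comm_ring_1 mpoly) \<Longrightarrow> homog (k * m) (f ^ m)"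
  by (induction m) (auto dest: homog_mult simp: homog_def[of _ 1])


subsection \<open>Linear algebra\<close>

definition poly_indep :: "nat set \<Rightarrow> (nat \<Rightarrow> 'a::field poly) \<Rightarrow> bool" where
  "poly_indep I h \<longleftrightarrow> (\<forall>c. (\<Sum>i\<in>I. smult (c i) (h i)) = 0 \<longrightarrow> (\<forall>i\<in>I. c i = 0))"

text \<open>Pivot elimination: subtracting multiples of a pivot from the other members makes them
  satisfy the condition, so one linear condition costs at most one member. \<open>P\<close> is a
  side condition closed under linear combinations, such as a degree bound, that has to survive the
  elimination.\<close>

lemma poly_indep_kernel:
  fixes psi :: "'a::field poly \<Rightarrow> 'a"
  assumes fin: "finite I" and ind: "poly_indep I h"
    and add: "\<And>p q. psi (p + q) = psi p + psi q" and sm: "\<And>c p. psi (smult c p) = c * psi p"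
    and P: "\<And>i. i \<in> I \<Longrightarrow> P (h i)"
    and Padd: "\<And>p q. P p \<Longrightarrow> P q \<Longrightarrow> P (p + q)" and Psm: "\<And>c p. P p \<Longrightarrow> P (smult c p)"
  shows "\<exists>J h'. J \<subseteq> I \<and> card I \<le> Suc (card J) \<and> poly_indep J h' \<and> (\<forall>j\<in>J. P (h' j) \<and> psi (h' j) = 0)"
proof (cases "\<forall>i\<in>I. psi (h i) = 0")
  case True
  then show ?thesis using ind P by (intro exI[of _ I] exI[of _ h]) auto
next
  case False
  then obtain r where r: "r \<in> I" "psi (h r) \<noteq> 0" by auto
  define m where "m j = - psi (h j) / psi (h r)" for j
  define h' where "h' j = h j + smult (m j) (h r)" for j
  have "poly_indep (I - {r}) h'"
    unfolding poly_indep_def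
  proof (intro allI impI)
    fix c assume c: "(\<Sum>i\<in>I - {r}. smult (c i) (h' i)) = 0"
    \<comment> \<open>A relation among the new members is one among the old ones once the pivot
      collects all its multiples.\<close>
    define c' where "c' = c(r := (\<Sum>i\<in>I - {r}. c i * m i))"
    have "(\<Sum>i\<in>I. smult (c' i) (h i)) = smult (c' r) (h r) + (\<Sum>i\<in>I - {r}. smult (c' i) (h i))"
      using fin r by (simp add: sum.remove)
    also have "(\<Sum>i\<in>I - {r}. smult (c' i) (h i)) = (\<Sum>i\<in>I - {r}. smult (c i) (h i))"
      by (rule sum.cong) (auto simp: c'_def)
    also have "smult (c' r) (h r) + (\<Sum>i\<in>I - {r}. smult (c i) (h i)) = (\<Sum>i\<in>I - {r}. smult (c i) (h' i))"
      by (simp add: c'_def h'_def smult_add_right sum.distrib smult_sum)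
    finally have "\<forall>i\<in>I. c' i = 0" using ind c by (auto simp: poly_indep_def)
    then show "\<forall>i\<in>I - {r}. c i = 0" unfolding c'_def by (metis DiffD1 DiffD2 fun_upd_other insertI1)
  qed
  moreover have "P (h' j) \<and> psi (h' j) = 0" if "j \<in> I - {r}" for j
    using that r P by (auto simp: h'_def intro!: Padd Psm) (simp add: add sm, simp add: m_def)
  moreover have "card I \<le> Suc (card (I - {r}))" using fin r by (simp add: card_Suc_Diff1)
  ultimately show ?thesis by blast
qed

lemma poly_indep_kernels:
  fixes psi :: "'q \<Rightarrow> 'a::field poly \<Rightarrow> 'a"
  assumes "finite Q" and fin: "finite I" and ind: "poly_indep I h"
    and add: "\<And>x p q. psi x (p + q) = psi x p + psi x q"
    and sm: "\<And>x c p. psi x (smult c p) = c * psi x p"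
    and P: "\<And>i. i \<in> I \<Longrightarrow> P (h i)"
    and Padd: "\<And>p q. P p \<Longrightarrow> P q \<Longrightarrow> P (p + q)" and Psm: "\<And>c p. P p \<Longrightarrow> P (smult c p)"
  shows "\<exists>J h'. J \<subseteq> I \<and> card I \<le> card J + card Q \<and> poly_indep J h' \<and>
    (\<forall>j\<in>J. P (h' j) \<and> (\<forall>x\<in>Q. psi x (h' j) = 0))"
  using assms(1)
proof (induction Q)
  case empty
  then show ?case using ind P by (intro exI[of _ I] exI[of _ h]) auto
next
  case (insert x Q)
  then obtain J h' where J: "J \<subseteq> I" "card I \<le> card J + card Q" "poly_indep J h'"
    "\<And>j. j \<in> J \<Longrightarrow> P (h' j) \<and> (\<forall>x\<in>Q. psi x (h' j) = 0)" by auto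
  have "\<exists>J' h''. J' \<subseteq> J \<and> card J \<le> Suc (card J') \<and> poly_indep J' h'' \<and>
    (\<forall>j\<in>J'. (P (h'' j) \<and> (\<forall>x\<in>Q. psi x (h'' j) = 0)) \<and> psi x (h'' j) = 0)"
    by (rule poly_indep_kernel) (use J fin finite_subset in \<open>auto simp: add sm intro: Padd Psm\<close>)
  then obtain J' h'' where J': "J' \<subseteq> J" "card J \<le> Suc (card J')" "poly_indep J' h''"
    "\<And>j. j \<in> J' \<Longrightarrow> (P (h'' j) \<and> (\<forall>x\<in>Q. psi x (h'' j) = 0)) \<and> psi x (h'' j) = 0" by blast
  have "J' \<subseteq> I \<and> card I \<le> card J' + card (insert x Q) \<and> poly_indep J' h'' \<and>
    (\<forall>j\<in>J'. P (h'' j) \<and> (\<forall>x\<in>insert x Q. psi x (h'' j) = 0))"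
    using J J' insert.hyps by auto
  then show ?case by blast
qed

lemma poly_indep_monom: "finite I \<Longrightarrow> poly_indep I (\<lambda>i. monom (1::'a::field) i)"
  unfolding poly_indep_def
proof (intro allI impI ballI)
  fix c :: "nat \<Rightarrow> 'a" and i
  assume I: "finite I" and eq: "(\<Sum>i\<in>I. smult (c i) (monom 1 i)) = 0" and i: "i \<in> I"
  have "coeff (\<Sum>i\<in>I. smult (c i) (monom 1 i)) i = c i"
    using I i by (simp add: coeff_sum if_distrib cong: if_cong)
  then show "c i = 0" using eq by simp
qed

text \<open>Vectors are encoded as polynomials with the coefficients as coordinates. The monomials
  indexed by \<open>I\<close> are independent, and \<open>card Q\<close> conditions leave at least
  one member of the family.\<close>

lemma homogeneous_system:
  fixes M :: "'q \<Rightarrow> nat \<Rightarrow> 'a::field"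
  assumes "finite Q" "finite I" "card Q < card I"
  shows "\<exists>c. (\<exists>i\<in>I. c i \<noteq> 0) \<and> (\<forall>q\<in>Q. (\<Sum>i\<in>I. M q i * c i) = 0)"
proof -
  have "\<exists>J h'. J \<subseteq> I \<and> card I \<le> card J + card Q \<and> poly_indep J h' \<and>
    (\<forall>j\<in>J. (\<forall>i. i \<notin> I \<longrightarrow> coeff (h' j) i = 0) \<and> (\<forall>x\<in>Q. (\<Sum>i\<in>I. M x i * coeff (h' j) i) = 0))"
    by (rule poly_indep_kernels[OF assms(1,2) poly_indep_monom[OF assms(2)]])
      (auto simp: algebra_simps sum.distrib sum_distrib_left)
  then obtain J h' where J: "J \<subseteq> I" "card I \<le> card J + card Q" "poly_indep J h'"
    "\<And>j. j \<in> J \<Longrightarrow> (\<forall>i. i \<notin> I \<longrightarrow> coeff (h' j) i = 0) \<and> (\<forall>x\<in>Q. (\<Sum>i\<in>I. M x i * coeff (h' j) i) = 0)"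
    by blast
  then obtain j where j: "j \<in> J" using assms by (metis card.empty add_0 leD ex_in_conv)
  have "h' j \<noteq> 0"
  proof
    assume "h' j = 0"
    then have "(\<Sum>i\<in>J. smult (if i = j then 1 else 0) (h' i)) = 0"
      by (intro sum.neutral) auto
    then show False using J(3) j by (fastforce simp: poly_indep_def)
  qed
  then obtain i where "coeff (h' j) i \<noteq> 0" by (metis leading_coeff_0_iff)
  then show ?thesis using J(4)[OF j] by (intro exI[of _ "coeff (h' j)"]) blast
qed

section \<open>Wronskians and orders of vanishing in linear systems of polynomials\<close>

definition wronskian :: "'a::field poly \<Rightarrow> 'a poly \<Rightarrow> 'a poly" where
  "wronskian h p = h * pderiv p - p * pderiv h"

lemma wronskian_sum_smult:
  "wronskian h (\<Sum>i\<in>I. smult (c i) (f i)) = (\<Sum>i\<in>I. smult (c i) (wronskian h (f i)))"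
  by (induction I rule: infinite_finite_induct)
    (auto simp: wronskian_def pderiv_add pderiv_smult algebra_simps smult_diff_right smult_add_right)

text \<open>Comparing leading coefficients in \<open>h * pderiv p = p * pderiv h\<close> equates the
  degrees as field elements, hence as numbers in characteristic zero.\<close>

lemma wronskian_eq_0_degree:
  fixes h p :: "'a::field_char_0 poly"
  assumes "h \<noteq> 0" "p \<noteq> 0" "wronskian h p = 0"
  shows "degree p = degree h"
proof -
  have eq: "h * pderiv p = p * pderiv h" using assms(3) by (simp add: wronskian_def)
  show ?thesis
  proof (cases "degree p = 0 \<or> degree h = 0")
    case True
    then have "pderiv p = 0 \<or> pderiv h = 0" by (auto simp: pderiv_eq_0_iff)
    then have "pderiv p = 0 \<and> pderiv h = 0" using eq assms by auto
    then show ?thesis by (simp add: pderiv_eq_0_iff)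
  next
    case False
    have lc: "lead_coeff (pderiv q) = of_nat (degree q) * lead_coeff q" if "degree q \<noteq> 0" for q :: "'a poly"
      using that by (simp add: degree_pderiv coeff_pderiv)
    have "lead_coeff h * (of_nat (degree p) * lead_coeff p) = lead_coeff p * (of_nat (degree h) * lead_coeff h)"
      using arg_cong[OF eq, of lead_coeff] lc[of p] lc[of h] False by (simp add: lead_coeff_mult)
    then have "(of_nat (degree p) :: 'a) = of_nat (degree h)" using assms by simp
    then show ?thesis by (simp only: of_nat_eq_iff)
  qed
qed

text \<open>Subtract the multiple of \<open>h\<close> with the same leading term. A nonzero
  remainder would again have zero Wronskian, but too small a degree.\<close>

lemma wronskian_eq_0:
  fixes h p :: "'a::field_char_0 poly"
  assumes "h \<noteq> 0" "wronskian h p = 0"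
  shows "\<exists>c. p = smult c h"
proof (cases "p = 0")
  case True then show ?thesis by (intro exI[of _ 0]) simp
next
  case False
  define c where "c = lead_coeff p / lead_coeff h"
  have deg: "degree p = degree h" using wronskian_eq_0_degree[OF assms(1) False assms(2)] .
  have w: "wronskian h (p - smult c h) = 0"
    using assms(2) by (simp add: wronskian_def pderiv_diff pderiv_smult algebra_simps smult_diff_right)
  have "p - smult c h = 0"
  proof (rule ccontr)
    assume nz: "p - smult c h \<noteq> 0"
    have d: "degree (p - smult c h) = degree h" using wronskian_eq_0_degree[OF assms(1) nz w] .
    have "coeff (p - smult c h) (degree h) = 0" using assms(1) deg by (simp add: c_def)
    then show False using nz d by (metis leading_coeff_0_iff)
  qed
  then show ?thesis by auto
qed

lemma power_dvd_pderiv: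
  fixes l p :: "'a::field poly"
  assumes "l ^ Suc k dvd p" shows "l ^ k dvd pderiv p"
proof -
  obtain q where q: "p = l ^ Suc k * q" using assms by (auto simp: dvd_def)
  have "pderiv p = l ^ k * (l * pderiv q + smult (of_nat (Suc k)) q * pderiv l)"
    unfolding q pderiv_mult pderiv_power_Suc by (simp add: algebra_simps)
  then show ?thesis by simp
qed

text \<open>Taking Wronskians with one member removes it from the family and lowers the
  order of vanishing by one.\<close>

lemma finite_high_order_vanishing:
  fixes h :: "nat \<Rightarrow> 'a::field_char_0 poly"
  assumes "finite I" "poly_indep I h"
  shows "finite {x. \<exists>c. (\<exists>i\<in>I. c i \<noteq> 0) \<and> [:-x, 1:] ^ card I dvd (\<Sum>i\<in>I. smult (c i) (h i))}"
  using assms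
proof (induction I arbitrary: h)
  case empty
  then show ?case by simp
next
  case (insert r I)
  have hr: "h r \<noteq> 0"
  proof
    assume "h r = 0"
    then have "(\<Sum>i\<in>insert r I. smult (if i = r then 1 else 0) (h i)) = 0"
      by (intro sum.neutral) auto
    then show False using insert.prems by (fastforce simp: poly_indep_def)
  qed
  define w where "w i = wronskian (h r) (h i)" for i
  have "poly_indep I w"
    unfolding poly_indep_def
  proof (intro allI impI)
    fix c assume "(\<Sum>i\<in>I. smult (c i) (w i)) = 0"
    then have "wronskian (h r) (\<Sum>i\<in>I. smult (c i) (h i)) = 0"
      by (simp add: w_def wronskian_sum_smult)
    then obtain k where k: "(\<Sum>i\<in>I. smult (c i) (h i)) = smult k (h r)"
      using wronskian_eq_0[OF hr] by blast
    define c' where "c' = c(r := - k)"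
    have "(\<Sum>i\<in>I. smult (c' i) (h i)) = (\<Sum>i\<in>I. smult (c i) (h i))"
      using insert.hyps by (intro sum.cong) (auto simp: c'_def)
    then have "(\<Sum>i\<in>insert r I. smult (c' i) (h i)) = 0"
      using insert.hyps k by (simp add: c'_def)
    then have "\<forall>i\<in>insert r I. c' i = 0" using insert.prems by (simp add: poly_indep_def)
    then show "\<forall>i\<in>I. c i = 0" using insert.hyps by (auto simp: c'_def split: if_splits)
  qed
  note fin = insert.IH[OF this]
  let ?S = "{x. \<exists>c. (\<exists>i\<in>I. c i \<noteq> 0) \<and> [:-x, 1:] ^ card I dvd (\<Sum>i\<in>I. smult (c i) (w i))}"
  \<comment> \<open>The roots of \<open>h r\<close> are excluded for the case that all coefficients
    on \<open>I\<close> vanish, where the combination is a multiple of \<open>h r\<close>.\<close>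
  have finU: "finite (?S \<union> {x. poly (h r) x = 0})" using fin poly_roots_finite[OF hr] by simp
  show ?case
  proof (rule finite_subset[OF _ finU], intro subsetI, rule ccontr)
    fix x assume x: "x \<in> {x. \<exists>c. (\<exists>i\<in>insert r I. c i \<noteq> 0) \<and>
        [:-x, 1:] ^ card (insert r I) dvd (\<Sum>i\<in>insert r I. smult (c i) (h i))}"
      and nx: "x \<notin> ?S \<union> {x. poly (h r) x = 0}"
    then have np: "poly (h r) x \<noteq> 0" by simp
    from x obtain c i where i: "i \<in> insert r I" "c i \<noteq> 0"
      and dvd: "[:-x, 1:] ^ card (insert r I) dvd (\<Sum>i\<in>insert r I. smult (c i) (h i))" by blast
    let ?p = "\<Sum>i\<in>insert r I. smult (c i) (h i)"
    have wr: "wronskian (h r) ?p = (\<Sum>i\<in>I. smult (c i) (w i))"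
      unfolding wronskian_sum_smult using insert.hyps by (simp add: w_def wronskian_def)
    obtain q where q: "?p = [:-x, 1:] ^ Suc (card I) * q"
      using dvd insert.hyps by (auto simp: dvd_def)
    have "[:-x, 1:] ^ card I dvd ?p" unfolding q power_Suc by (intro dvd_mult2 dvd_mult dvd_refl)
    moreover have "[:-x, 1:] ^ card I dvd pderiv ?p"
      by (rule power_dvd_pderiv) (simp add: q del: power_Suc)
    ultimately have wd: "[:-x, 1:] ^ card I dvd (\<Sum>i\<in>I. smult (c i) (w i))"
      unfolding wr[symmetric] wronskian_def by (intro dvd_diff dvd_mult dvd_mult2)
    then have z: "c i = 0" if "i \<in> I" for i using that nx by blast
    then have "c r \<noteq> 0" using i by auto
    moreover have "?p = smult (c r) (h r)" using z insert.hyps by simp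
    ultimately show False using np arg_cong[OF q, of "\<lambda>p. poly p x"] by simp
  qed
qed

lemma poly_indep_subset:
  assumes "poly_indep J h" "K \<subseteq> J" "finite J" shows "poly_indep K h"
  unfolding poly_indep_def
proof (intro allI impI)
  fix c assume c: "(\<Sum>i\<in>K. smult (c i) (h i)) = 0"
  have "(\<Sum>i\<in>J. smult (if i \<in> K then c i else 0) (h i)) = (\<Sum>i\<in>K. smult (c i) (h i))"
    using assms by (intro sum.mono_neutral_cong_right) auto
  then have "\<forall>i\<in>J. (if i \<in> K then c i else 0) = 0"
    using assms(1)[unfolded poly_indep_def, THEN spec, of "\<lambda>i. if i \<in> K then c i else 0"] c by simp
  then show "\<forall>i\<in>K. c i = 0" using assms(2) by (metis subsetD)
qed

lemma sum_smult_mod: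
  fixes q :: "'a::field poly"
  shows "(\<Sum>i\<in>I. smult (c i) (h i)) mod q = (\<Sum>i\<in>I. smult (c i) (h i mod q))"
  by (induction I rule: infinite_finite_induct) (simp_all add: poly_mod_add_left mod_smult_left)

lemma smult_sum2: "smult c (\<Sum>i\<in>I. f i) = (\<Sum>i\<in>I. smult c (f i))"
  by (induction I rule: infinite_finite_induct) (simp_all add: smult_add_right)

text \<open>Dimension count: modulo a polynomial of degree \<open>card J\<close>, the
  \<open>card J + 1\<close> polynomials \<open>p\<close> and \<open>h i\<close> are dependent, and
  the hypothesis forces \<open>p\<close> to take part in the dependency.\<close>

lemma solve_mod_power:
  fixes h :: "nat \<Rightarrow> 'a::field_char_0 poly"
  assumes J: "finite J" and np: "\<not> (\<exists>c. (\<exists>i\<in>J. c i \<noteq> 0) \<and> [:-x, 1:] ^ card J dvd (\<Sum>i\<in>J. smult (c i) (h i)))"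
  shows "\<exists>c. [:-x, 1:] ^ card J dvd p - (\<Sum>i\<in>J. smult (c i) (h i))"
proof -
  let ?q = "[:-x, 1:] ^ card J"
  obtain r where r: "r \<notin> J" using J by (meson ex_new_if_finite infinite_UNIV_nat)
  define v where "v = h(r := p)"
  have vJ: "(\<Sum>i\<in>J. smult (c i) (v i)) = (\<Sum>i\<in>J. smult (c i) (h i))" for c
    using r by (intro sum.cong) (auto simp: v_def)
  have "\<exists>c. (\<exists>i\<in>insert r J. c i \<noteq> 0) \<and> (\<forall>k\<in>{..<card J}. (\<Sum>i\<in>insert r J. coeff (v i mod ?q) k * c i) = 0)"
    by (rule homogeneous_system) (use J r in auto)
  then obtain c where c: "\<exists>i\<in>insert r J. c i \<noteq> 0"
    "\<And>k. k < card J \<Longrightarrow> (\<Sum>i\<in>insert r J. coeff (v i mod ?q) k * c i) = 0" by auto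
  have q0: "?q \<noteq> 0" by simp
  have dq: "degree ?q = card J" by (simp add: degree_linear_power)
  let ?s = "\<Sum>i\<in>insert r J. smult (c i) (v i)"
  have "?s mod ?q = 0"
  proof (rule poly_eqI)
    fix k
    show "coeff (?s mod ?q) k = coeff 0 k"
    proof (cases "k < card J")
      case True
      have "coeff (?s mod ?q) k = (\<Sum>i\<in>insert r J. coeff (v i mod ?q) k * c i)"
        unfolding sum_smult_mod by (simp only: coeff_sum coeff_smult mult.commute[of "c _"])
      then show ?thesis using c(2)[OF True] by simp
    next
      case False
      have "?s mod ?q = 0 \<or> degree (?s mod ?q) < card J" using degree_mod_less[OF q0, of ?s] dq by simp
      then show ?thesis using False by (auto simp: coeff_eq_0)
    qed
  qed
  then have dvd: "?q dvd ?s" by (simp only: dvd_eq_mod_eq_0)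
  have s_eq: "?s = smult (c r) p + (\<Sum>i\<in>J. smult (c i) (h i))"
    using J r vJ by (simp add: v_def)
  have cr: "c r \<noteq> 0"
  proof
    assume "c r = 0"
    then have "?q dvd (\<Sum>i\<in>J. smult (c i) (h i))" "\<exists>i\<in>J. c i \<noteq> 0" using dvd s_eq c(1) by auto
    then show False using np by blast
  qed
  have "?q dvd smult (inverse (c r)) ?s" using dvd by (rule dvd_smult)
  also have "smult (inverse (c r)) ?s = p - (\<Sum>i\<in>J. smult (- inverse (c r) * c i) (h i))"
    unfolding s_eq using cr smult_sum2[of "inverse (c r)" "\<lambda>i. smult (c i) (h i)" J]
    by (simp add: smult_add_right sum_negf)
  finally show ?thesis by (intro exI[of _ "\<lambda>i. - inverse (c r) * c i"])
qed

text \<open>The determinant of \<open>B + e A\<close> is a polynomial in \<open>e\<close>.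
  Injectivity of \<open>B\<close> makes it nonzero at \<open>e = 0\<close>, so it has finitely many
  roots.\<close>

lemma finite_singular_pencil:
  fixes A B :: "'i \<Rightarrow> 'i \<Rightarrow> 'a::field"
  assumes fin: "finite S"
    and inj: "\<And>y. (\<And>q. q \<in> S \<Longrightarrow> (\<Sum>p\<in>S. B q p * y p) = 0) \<Longrightarrow> (\<forall>p\<in>S. y p = 0)"
  shows "finite {e. \<exists>y. (\<exists>p\<in>S. y p \<noteq> 0) \<and> (\<forall>q\<in>S. (\<Sum>p\<in>S. (B q p + e * A q p) * y p) = 0)}"
proof -
  define N where "N = card S"
  obtain g where g: "bij_betw g {0..<N} S"
    using ex_bij_betw_nat_finite[OF fin] unfolding N_def by blast
  \<comment> \<open>The entries are linear polynomials in the parameter; evaluation at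
    \<open>e\<close> is a ring homomorphism and commutes with the determinant.\<close>
  define P where "P = mat N N (\<lambda>(i, j). [:B (g i) (g j), A (g i) (g j):])"
  define M where "M e = mat N N (\<lambda>(i, j). B (g i) (g j) + e * A (g i) (g j))" for e
  have M: "M e \<in> carrier_mat N N" for e by (simp add: M_def)
  have det: "det (M e) = poly (det P) e" for e
  proof -
    interpret comm_ring_hom "\<lambda>p. poly p e" by (unfold_locales) auto
    have "map_mat (\<lambda>p. poly p e) P = M e" by (rule eq_matI) (auto simp: P_def M_def)
    then show ?thesis using hom_det[of P] by simp
  qed
  have key: "det (M e) = 0 \<longleftrightarrow> (\<exists>y. (\<exists>p\<in>S. y p \<noteq> 0) \<and> (\<forall>q\<in>S. (\<Sum>p\<in>S. (B q p + e * A q p) * y p) = 0))" for e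
  proof
    assume "det (M e) = 0"
    then obtain v where v: "v \<in> carrier_vec N" "v \<noteq> 0\<^sub>v N" "M e *\<^sub>v v = 0\<^sub>v N"
      using det_0_iff_vec_prod_zero[OF M] by blast
    define y where "y p = v $ (the_inv_into {0..<N} g p)" for p
    have yg: "y (g j) = v $ j" if "j < N" for j
      using g that by (simp add: y_def the_inv_into_f_f bij_betw_def)
    obtain j where j: "j < N" "v $ j \<noteq> 0" using v(1,2) by (metis eq_vecI carrier_vecD index_zero_vec)
    have "g j \<in> S" using g j by (auto simp: bij_betw_def)
    moreover have "y (g j) \<noteq> 0" using yg j by simp
    moreover have "(\<Sum>p\<in>S. (B q p + e * A q p) * y p) = 0" if qS: "q \<in> S" for q
    proof -
      obtain i where i: "i < N" "q = g i" using g qS by (auto simp: bij_betw_def)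
      have "(\<Sum>p\<in>S. (B q p + e * A q p) * y p) = (\<Sum>j\<in>{0..<N}. (B q (g j) + e * A q (g j)) * y (g j))"
        by (rule sum.reindex_bij_betw[OF g, symmetric])
      also have "\<dots> = (M e *\<^sub>v v) $ i"
        using i v(1) by (auto simp: M_def scalar_prod_def yg intro!: sum.cong)
      finally show ?thesis using v(3) i by simp
    qed
    ultimately show "\<exists>y. (\<exists>p\<in>S. y p \<noteq> 0) \<and> (\<forall>q\<in>S. (\<Sum>p\<in>S. (B q p + e * A q p) * y p) = 0)"
      by blast
  next
    assume "\<exists>y. (\<exists>p\<in>S. y p \<noteq> 0) \<and> (\<forall>q\<in>S. (\<Sum>p\<in>S. (B q p + e * A q p) * y p) = 0)"
    then obtain y p where y: "p \<in> S" "y p \<noteq> 0" "\<And>q. q \<in> S \<Longrightarrow> (\<Sum>p\<in>S. (B q p + e * A q p) * y p) = 0"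
      by blast
    define v where "v = vec N (\<lambda>j. y (g j))"
    obtain j where j: "j < N" "p = g j" using g y(1) by (auto simp: bij_betw_def)
    have "v \<noteq> 0\<^sub>v N"
    proof
      assume "v = 0\<^sub>v N"
      then have "v $ j = 0" using j by simp
      then show False using j y by (simp add: v_def)
    qed
    moreover have "M e *\<^sub>v v = 0\<^sub>v N"
    proof (rule eq_vecI)
      fix i assume "i < dim_vec (0\<^sub>v N :: 'a vec)"
      then have i: "i < N" by simp
      have "(M e *\<^sub>v v) $ i = (\<Sum>j\<in>{0..<N}. (B (g i) (g j) + e * A (g i) (g j)) * y (g j))"
        using i by (auto simp: M_def scalar_prod_def v_def intro!: sum.cong)
      also have "\<dots> = (\<Sum>p\<in>S. (B (g i) p + e * A (g i) p) * y p)"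
        by (rule sum.reindex_bij_betw[OF g])
      also have "\<dots> = 0" using g i by (intro y(3)) (auto simp: bij_betw_def)
      finally show "(M e *\<^sub>v v) $ i = 0\<^sub>v N $ i" using i by simp
    qed (simp add: M_def)
    moreover have "v \<in> carrier_vec N" by (simp add: v_def)
    ultimately show "det (M e) = 0" using det_0_iff_vec_prod_zero[OF M] by blast
  qed
  have "det (M 0) \<noteq> 0"
    unfolding key using inj by simp blast
  then have "det P \<noteq> 0" by (auto simp: det)
  then have "finite {e. poly (det P) e = 0}" by (rule poly_roots_finite)
  then show ?thesis unfolding key[symmetric] det .
qed

section \<open>Solvability of linear equations on spaces of polynomials\<close>

definition mlinear :: "('a::field mpoly \<Rightarrow> 'a) \<Rightarrow> bool" where
  "mlinear f \<longleftrightarrow> (\<forall>p q. f (p + q) = f p + f q) \<and> (\<forall>c p. f (single 0 c * p) = c * f p)"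

definition msubspace :: "'a::field mpoly set \<Rightarrow> bool" where
  "msubspace V \<longleftrightarrow> 0 \<in> V \<and> (\<forall>p\<in>V. \<forall>q\<in>V. p + q \<in> V) \<and> (\<forall>c. \<forall>p\<in>V. single 0 c * p \<in> V)"

text \<open>The vectors \<open>l\<close> are the linear relations among the functionals on
  \<open>V\<close>, and the right-hand side has to respect them. In the induction one equation is
  solved by a multiple of \<open>f1\<close>, and the others inside the kernel of
  \<open>psi r\<close>.\<close>

lemma fredholm_alternative:
  fixes psi :: "'q \<Rightarrow> 'a::field mpoly \<Rightarrow> 'a"
  assumes "finite Q" "msubspace V" "\<And>q. mlinear (psi q)"
    and "\<And>l. (\<And>f. f \<in> V \<Longrightarrow> (\<Sum>q\<in>Q. l q * psi q f) = 0) \<Longrightarrow> (\<Sum>q\<in>Q. l q * y q) = 0"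
  shows "\<exists>f\<in>V. \<forall>q\<in>Q. psi q f = y q"
  using assms
proof (induction Q arbitrary: V y)
  case empty
  then show ?case by (auto simp: msubspace_def)
next
  case (insert r Q)
  note lin = insert.prems(2)[unfolded mlinear_def]
  have add: "psi q (f + g) = psi q f + psi q g" and sm: "psi q (single 0 c * f) = c * psi q f" for q f g c
    using lin by auto
  note sub = insert.prems(1)[unfolded msubspace_def]
  show ?case
  proof (cases "\<forall>f\<in>V. psi r f = 0")
    case True
    have yr: "y r = 0"
      using insert.prems(3)[of "\<lambda>q. if q = r then 1 else 0"] True insert.hyps
      by (auto simp: if_distrib[of "\<lambda>x. x * _"] cong: if_cong)
    have "\<exists>f\<in>V. \<forall>q\<in>Q. psi q f = y q"
    proof (rule insert.IH[OF insert.prems(1,2)])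
      fix l assume l: "\<And>f. f \<in> V \<Longrightarrow> (\<Sum>q\<in>Q. l q * psi q f) = 0"
      have "(\<Sum>q\<in>insert r Q. l q * y q) = 0"
        using l True insert.hyps by (intro insert.prems(3)) auto
      then show "(\<Sum>q\<in>Q. l q * y q) = 0" using yr insert.hyps by simp
    qed
    then show ?thesis using True yr by auto
  next
    case False
    then obtain f0 where f0: "f0 \<in> V" "psi r f0 \<noteq> 0" by blast
    define f1 where "f1 = single 0 (inverse (psi r f0)) * f0"
    have f1: "f1 \<in> V" "psi r f1 = 1" using f0 sub by (auto simp: f1_def sm)
    define V' where "V' = {f \<in> V. psi r f = 0}"
    have psi0: "psi q 0 = 0" for q using sm[of q 0 0] by simp
    have V': "msubspace V'" using sub by (auto simp: msubspace_def V'_def add sm psi0)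
    have "\<exists>f\<in>V'. \<forall>q\<in>Q. psi q f = y q - y r * psi q f1"
    proof (rule insert.IH[OF V' insert.prems(2)])
      fix l assume l: "\<And>f. f \<in> V' \<Longrightarrow> (\<Sum>q\<in>Q. l q * psi q f) = 0"
      define m where "m = (\<Sum>q\<in>Q. l q * psi q f1)"
      \<comment> \<open>The coefficient at \<open>r\<close> makes the extended relation vanish on
        \<open>f1\<close>, hence on all of \<open>V\<close>.\<close>
      define l' where "l' = l(r := - m)"
      have l'Q: "(\<Sum>q\<in>Q. l' q * z q) = (\<Sum>q\<in>Q. l q * z q)" for z :: "'q \<Rightarrow> 'a"
        using insert.hyps by (intro sum.cong) (auto simp: l'_def)
      have "(\<Sum>q\<in>insert r Q. l' q * y q) = 0"
      proof (rule insert.prems(3))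
        fix f assume f: "f \<in> V"
        define f' where "f' = f + single 0 (- psi r f) * f1"
        have "f' \<in> V'" using f f1 sub by (auto simp: V'_def f'_def add sm)
        then have "(\<Sum>q\<in>Q. l q * psi q f') = 0" by (rule l)
        moreover have "l q * psi q f' = l q * psi q f - l q * psi q f1 * psi r f" for q
          unfolding f'_def add sm by (simp add: algebra_simps)
        ultimately have "(\<Sum>q\<in>Q. l q * psi q f) = m * psi r f"
          by (simp add: m_def sum_subtractf sum_distrib_right)
        then show "(\<Sum>q\<in>insert r Q. l' q * psi q f) = 0"
          using insert.hyps l'Q[of "\<lambda>q. psi q f"] by (simp add: l'_def)
      qed
      then have "(\<Sum>q\<in>Q. l q * y q) = m * y r"
        using insert.hyps l'Q[of y] by (simp add: l'_def)
      then show "(\<Sum>q\<in>Q. l q * (y q - y r * psi q f1)) = 0"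
        by (simp add: m_def algebra_simps sum_subtractf sum_distrib_left)
    qed
    then obtain f where f: "f \<in> V" "psi r f = 0" "\<And>q. q \<in> Q \<Longrightarrow> psi q f = y q - y r * psi q f1"
      by (auto simp: V'_def)
    have "f + single 0 (y r) * f1 \<in> V" using f f1 sub by blast
    moreover have "\<forall>q\<in>insert r Q. psi q (f + single 0 (y r) * f1) = y q"
      using f f1 by (simp add: add sm)
    ultimately show ?thesis by blast
  qed
qed


subsection \<open>The \<open>sl\<^sub>2\<close> argument for monomial complete intersections\<close>


text \<open>The model is the function that sends \<open>q\<close> to the coefficient of
  \<open>X\<^sup>\<beta>\<close> in \<open>f * xp q\<close>, for a form \<open>f\<close> of degree
  \<open>i\<close>. It lives on the divisors of \<open>\<beta>\<close> of complementary
  degree.\<close>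

definition boxed :: "(nat \<Rightarrow>\<^sub>0 nat) \<Rightarrow> nat \<Rightarrow> ((nat \<Rightarrow>\<^sub>0 nat) \<Rightarrow> 'a::zero) \<Rightarrow> bool" where
  "boxed \<beta> i \<phi> \<longleftrightarrow> (\<forall>p. \<phi> p \<noteq> 0 \<longrightarrow> p \<preceq> \<beta> \<and> mdeg p + i = mdeg \<beta>)"

text \<open>In the model, this is multiplication of \<open>f\<close> by the sum of the variables in
  \<open>N\<close>.\<close>

definition shiftE :: "nat set \<Rightarrow> ((nat \<Rightarrow>\<^sub>0 nat) \<Rightarrow> 'a::comm_ring_1) \<Rightarrow> (nat \<Rightarrow>\<^sub>0 nat) \<Rightarrow> 'a" where
  "shiftE N \<phi> p = (\<Sum>l\<in>N. \<phi> (p + single l 1))"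

text \<open>The weight vanishes at \<open>lookup p l = 0\<close>, where the exponent subtraction
  truncates, and at one past \<open>lookup \<beta> l\<close>, so the operator does not leave the
  box.\<close>

definition shiftF :: "nat set \<Rightarrow> (nat \<Rightarrow>\<^sub>0 nat) \<Rightarrow> ((nat \<Rightarrow>\<^sub>0 nat) \<Rightarrow> 'a::comm_ring_1) \<Rightarrow> (nat \<Rightarrow>\<^sub>0 nat) \<Rightarrow> 'a" where
  "shiftF N \<beta> \<phi> p = (\<Sum>l\<in>N. (of_nat (lookup \<beta> l) - of_nat (lookup p l) + 1) * of_nat (lookup p l) * \<phi> (p - single l 1))"

lemma boxed_shiftE:
  assumes "boxed \<beta> i \<phi>" shows "boxed \<beta> (Suc i) (shiftE N \<phi>)"
  unfolding boxed_def
proof (intro allI impI)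
  fix p assume "shiftE N \<phi> p \<noteq> 0"
  then obtain l where "\<phi> (p + single l 1) \<noteq> 0" unfolding shiftE_def by (meson sum.neutral)
  then have *: "p + single l 1 \<preceq> \<beta>" "mdeg (p + single l 1) + i = mdeg \<beta>" using assms by (auto simp: boxed_def)
  then have "lookup p j \<le> lookup \<beta> j" for j unfolding mdvd_def lookup_add by (meson add_leD1)
  then show "p \<preceq> \<beta> \<and> mdeg p + Suc i = mdeg \<beta>" using *(2) by (auto simp: mdvd_def mdeg_add)
qed

lemma shiftF_term_nz:
  fixes \<phi> :: "(nat \<Rightarrow>\<^sub>0 nat) \<Rightarrow> 'a::field_char_0"
  assumes "boxed \<beta> i \<phi>" "shiftF N \<beta> \<phi> p \<noteq> 0"
  shows "p \<preceq> \<beta> \<and> mdeg p + i = Suc (mdeg \<beta>)"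
proof -
  from assms(2) obtain l where nz:
    "((of_nat (lookup \<beta> l) - of_nat (lookup p l) + 1) * of_nat (lookup p l) * \<phi> (p - single l 1)) \<noteq> 0"
    unfolding shiftF_def by (meson sum.neutral)
  then have pl: "lookup p l \<noteq> 0" and "\<phi> (p - single l 1) \<noteq> 0" by auto
  then have *: "p - single l 1 \<preceq> \<beta>" "mdeg (p - single l 1) + i = mdeg \<beta>" using assms by (auto simp: boxed_def)
  have "lookup p l \<noteq> lookup \<beta> l + 1" using nz by auto
  moreover have "lookup (p - single l 1) j \<le> lookup \<beta> j" for j using *(1) by (simp add: mdvd_def)
  ultimately have "lookup p j \<le> lookup \<beta> j" for j
    by (cases "j = l") (force simp: lookup_minus lookup_single when_def split: if_splits)+
  moreover have "single l 1 \<preceq> p" using pl by (auto simp: mdvd_def lookup_single when_def)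
  from mdvd_add_diff[OF this] have "mdeg p = mdeg (p - single l 1) + 1"
    by (metis mdeg_add mdeg_single)
  ultimately show ?thesis using * by (auto simp: mdvd_def)
qed

lemma boxed_shiftF:
  fixes \<phi> :: "(nat \<Rightarrow>\<^sub>0 nat) \<Rightarrow> 'a::field_char_0"
  assumes "boxed \<beta> (Suc i) \<phi>" shows "boxed \<beta> i (shiftF N \<beta> \<phi>)"
  using shiftF_term_nz[OF assms] by (force simp: boxed_def)

lemma boxed_shiftF_0:
  fixes \<phi> :: "(nat \<Rightarrow>\<^sub>0 nat) \<Rightarrow> 'a::field_char_0"
  assumes "boxed \<beta> 0 \<phi>" shows "shiftF N \<beta> \<phi> p = 0"
  using shiftF_term_nz[OF assms, of N p] mdvd_mdeg[of p \<beta>] by force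

text \<open>The weights in \<open>shiftF\<close> are those of the lowering operator on the tensor product of the
  irreducible representations of dimension \<open>lookup \<beta> l + 1\<close>.\<close>

lemma shift_commutator:
  fixes \<phi> :: "(nat \<Rightarrow>\<^sub>0 nat) \<Rightarrow> 'a::field_char_0"
  assumes N: "finite N" "keys \<beta> \<subseteq> N" and \<phi>: "boxed \<beta> i \<phi>"
  shows "shiftF N \<beta> (shiftE N \<phi>) p = shiftE N (shiftF N \<beta> \<phi>) p + (of_nat (mdeg \<beta>) - 2 * of_nat i) * \<phi> p"
proof -
  let ?w = "\<lambda>p l. (of_nat (lookup \<beta> l) - of_nat (lookup p l) + 1) * of_nat (lookup p l) :: 'a"
  have FE: "shiftF N \<beta> (shiftE N \<phi>) p = (\<Sum>l\<in>N. \<Sum>k\<in>N. ?w p l * \<phi> (p - single l 1 + single k 1))"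
    by (simp add: shiftF_def shiftE_def sum_distrib_left)
  have EF: "shiftE N (shiftF N \<beta> \<phi>) p = (\<Sum>l\<in>N. \<Sum>k\<in>N. ?w (p + single k 1) l * \<phi> (p + single k 1 - single l 1))"
    unfolding shiftE_def shiftF_def by (rule sum.swap)
  \<comment> \<open>For \<open>k \<noteq> l\<close> the weight in direction \<open>l\<close> ignores
    the shift in direction \<open>k\<close>, and the terms cancel. On the diagonal the two weights
    differ by \<open>2 * lookup p l - lookup \<beta> l\<close>.\<close>
  have t: "?w p l * \<phi> (p - single l 1 + single k 1) - ?w (p + single k 1) l * \<phi> (p + single k 1 - single l 1)
      = (if k = l then (2 * of_nat (lookup p l) - of_nat (lookup \<beta> l)) * \<phi> p else 0)" for l k
  proof (cases "lookup p l = 0")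
    case True
    show ?thesis
    proof (cases "k = l")
      case False
      then show ?thesis using True by (simp add: lookup_add lookup_single)
    next
      case eq: True
      show ?thesis using True by (simp add: lookup_add lookup_single eq)
    qed
  next
    case False
    then have s: "single l 1 \<preceq> p" by (auto simp: mdvd_def lookup_single when_def)
    have e1: "p - single l 1 + single k 1 = p + single k 1 - single l 1"
      using False by (intro poly_mapping_eqI) (auto simp: lookup_minus lookup_add lookup_single when_def)
    show ?thesis
    proof (cases "k = l")
      case False
      then show ?thesis using e1 by (simp add: lookup_add lookup_single)
    next
      case True
      have "p + single l 1 - single l 1 = p" by simp
      then show ?thesis using e1 True by (simp add: lookup_add algebra_simps)
    qed
  qed
  have "shiftF N \<beta> (shiftE N \<phi>) p - shiftE N (shiftF N \<beta> \<phi>) p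
      = (\<Sum>l\<in>N. (2 * of_nat (lookup p l) - of_nat (lookup \<beta> l)) * \<phi> p)"
    unfolding FE EF sum_subtractf[symmetric] t using N by (simp add: sum.delta)
  also have "\<dots> = (of_nat (mdeg \<beta>) - 2 * of_nat i) * \<phi> p"
  proof (cases "\<phi> p = 0")
    case False
    then have p: "p \<preceq> \<beta>" "mdeg p + i = mdeg \<beta>" using \<phi> by (auto simp: boxed_def)
    have "keys p \<subseteq> N" using mdvd_keys[OF p(1)] N by blast
    then have "(\<Sum>l\<in>N. (2 * of_nat (lookup p l) - of_nat (lookup \<beta> l)) * \<phi> p)
        = (2 * of_nat (mdeg p) - of_nat (mdeg \<beta>)) * \<phi> p"
      using N by (simp add: mdeg_eq_sum[of N] sum_distrib_right[symmetric] sum_subtractf sum_distrib_left)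
    also have "\<dots> = (of_nat (mdeg \<beta>) - 2 * of_nat i) * \<phi> p"
      unfolding p(2)[symmetric] by (simp add: algebra_simps)
    finally show ?thesis .
  qed simp
  finally show ?thesis by (simp add: algebra_simps)
qed

lemma shiftE_add: "shiftE N (\<lambda>p. f p + g p) = (\<lambda>p. shiftE N f p + shiftE N g p)"
  by (simp add: shiftE_def sum.distrib fun_eq_iff)

lemma shiftE_smult: "shiftE N (\<lambda>p. c * f p) = (\<lambda>p. c * shiftE N f p)"
  by (simp add: shiftE_def sum_distrib_left fun_eq_iff)

lemma shiftE_0: "shiftE N (\<lambda>p. 0) = (\<lambda>p. 0)"
  by (simp add: shiftE_def fun_eq_iff)

lemma boxed_shiftE_power: "boxed \<beta> i \<phi> \<Longrightarrow> boxed \<beta> (i + m) ((shiftE N ^^ m) \<phi>)"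
  by (induction m) (auto dest: boxed_shiftE)

text \<open>The factor is the sum of the single commutator scalars
  \<open>mdeg \<beta> - 2 * (i + j)\<close> over \<open>j \<le> m\<close>.\<close>

lemma shift_commutator_power:
  fixes \<phi> :: "(nat \<Rightarrow>\<^sub>0 nat) \<Rightarrow> 'a::field_char_0"
  assumes N: "finite N" "keys \<beta> \<subseteq> N" and \<phi>: "boxed \<beta> i \<phi>"
  shows "shiftF N \<beta> ((shiftE N ^^ Suc m) \<phi>) = (\<lambda>p. (shiftE N ^^ Suc m) (shiftF N \<beta> \<phi>) p
     + (of_nat (Suc m) * (of_nat (mdeg \<beta>) - 2 * of_nat i - of_nat m)) * (shiftE N ^^ m) \<phi> p)"
proof (induction m)
  case 0
  show ?case using shift_commutator[OF N \<phi>] by (simp add: fun_eq_iff)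
next
  case (Suc m)
  have "shiftF N \<beta> ((shiftE N ^^ Suc (Suc m)) \<phi>) = shiftF N \<beta> (shiftE N ((shiftE N ^^ Suc m) \<phi>))" by simp
  also have "\<dots> = (\<lambda>p. shiftE N (shiftF N \<beta> ((shiftE N ^^ Suc m) \<phi>)) p
      + (of_nat (mdeg \<beta>) - 2 * of_nat (i + Suc m)) * (shiftE N ^^ Suc m) \<phi> p)"
    using shift_commutator[OF N boxed_shiftE_power[OF \<phi>]] by (simp only: fun_eq_iff) simp
  also have "\<dots> = (\<lambda>p. (shiftE N ^^ Suc (Suc m)) (shiftF N \<beta> \<phi>) p
     + (of_nat (Suc (Suc m)) * (of_nat (mdeg \<beta>) - 2 * of_nat i - of_nat (Suc m))) * (shiftE N ^^ Suc m) \<phi> p)"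
    unfolding Suc shiftE_add shiftE_smult by (simp add: fun_eq_iff algebra_simps)
  finally show ?case .
qed

text \<open>Induction on \<open>i\<close>. The commutator shows that
  \<open>shiftF N \<beta> \<phi>\<close>, one degree lower, is killed by the next power of
  \<open>shiftE\<close>; so it is zero and \<open>\<phi>\<close> is primitive. On primitive elements
  the commutator lowers \<open>m\<close> at the price of a scalar, which the bound on
  \<open>m + 2 * i\<close> keeps nonzero.\<close>

lemma shiftE_power_inj:
  fixes \<phi> :: "(nat \<Rightarrow>\<^sub>0 nat) \<Rightarrow> 'a::field_char_0"
  assumes N: "finite N" "keys \<beta> \<subseteq> N" and "boxed \<beta> i \<phi>"
    and "(shiftE N ^^ m) \<phi> = (\<lambda>p. 0)" and "m + 2 * i \<le> mdeg \<beta>"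
  shows "\<phi> = (\<lambda>p. 0)"
  using assms(3-)
proof (induction i arbitrary: \<phi> m)
  have F0: "shiftF N \<beta> (\<lambda>p. 0) = (\<lambda>p. 0 :: 'a)" by (simp add: shiftF_def fun_eq_iff)
  {
    fix \<phi> :: "(nat \<Rightarrow>\<^sub>0 nat) \<Rightarrow> 'a" and i m
    assume b: "boxed \<beta> i \<phi>" and F: "shiftF N \<beta> \<phi> = (\<lambda>p. 0)"
    have "(shiftE N ^^ m) \<phi> = (\<lambda>p. 0) \<Longrightarrow> m + 2 * i \<le> mdeg \<beta> \<Longrightarrow> \<phi> = (\<lambda>p. 0)"
    proof (induction m)
      case (Suc m)
      have E0: "(shiftE N ^^ k) (\<lambda>p. 0) = (\<lambda>p. 0 :: 'a)" for k by (induction k) (auto simp: shiftE_0)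
      have "(of_nat (Suc m) * (of_nat (mdeg \<beta>) - 2 * of_nat i - of_nat m)) * (shiftE N ^^ m) \<phi> p = 0" for p
        using fun_cong[OF shift_commutator_power[OF N b, of m], of p] unfolding Suc.prems F F0 E0 by simp
      moreover have "(of_nat (mdeg \<beta>) - 2 * of_nat i - of_nat m :: 'a) = of_nat (mdeg \<beta> - 2 * i - m)"
        using Suc.prems by (simp add: of_nat_diff)
      moreover have "mdeg \<beta> - 2 * i - m \<noteq> 0" using Suc.prems by simp
      ultimately have "(shiftE N ^^ m) \<phi> p = 0" for p by (metis mult_eq_0_iff of_nat_eq_0_iff nat.distinct(1))
      then show ?case using Suc by (simp add: fun_eq_iff)
    qed simp
  } note step = this
  {
    case 0
    have "shiftF N \<beta> \<phi> = (\<lambda>p. 0)" using boxed_shiftF_0[OF 0(1)] by (simp add: fun_eq_iff)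
    then show ?case using step[OF 0(1)] 0 by blast
  next
    case (Suc i)
    have "(shiftE N ^^ Suc m) (shiftF N \<beta> \<phi>) = (\<lambda>p. 0)"
    proof (cases m)
      case 0
      then have "\<phi> = (\<lambda>p. 0)" using Suc.prems by simp
      then show ?thesis using F0 0 by (simp add: shiftE_0)
    next
      case (Suc m')
      have "(\<lambda>p. (shiftE N ^^ m) (shiftF N \<beta> \<phi>) p
        + (of_nat m * (of_nat (mdeg \<beta>) - 2 * of_nat (Suc i) - of_nat m')) * (shiftE N ^^ m') \<phi> p) = (\<lambda>p. 0)"
        using shift_commutator_power[OF N Suc.prems(1), of m'] Suc.prems(2) F0 Suc by simp
      \<comment> \<open>One more application of \<open>shiftE\<close> turns the second summand into
        a multiple of the vanishing \<open>m\<close>-th power.\<close>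
      then have "shiftE N (\<lambda>p. (shiftE N ^^ m) (shiftF N \<beta> \<phi>) p
        + (of_nat m * (of_nat (mdeg \<beta>) - 2 * of_nat (Suc i) - of_nat m')) * (shiftE N ^^ m') \<phi> p) = (\<lambda>p. 0)"
        by (simp add: shiftE_0)
      then have "(\<lambda>p. (shiftE N ^^ Suc m) (shiftF N \<beta> \<phi>) p
        + (of_nat m * (of_nat (mdeg \<beta>) - 2 * of_nat (Suc i) - of_nat m')) * (shiftE N ^^ m) \<phi> p) = (\<lambda>p. 0)"
        unfolding shiftE_add shiftE_smult Suc by simp
      then show ?thesis using Suc.prems(2) by simp
    qed
    then have "shiftF N \<beta> \<phi> = (\<lambda>p. 0)"
      by (rule Suc.IH[OF boxed_shiftF[OF Suc.prems(1)]]) (use Suc.prems(3) in simp)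
    then show ?case using step[OF Suc.prems(1)] Suc.prems by blast
  }
qed


subsection \<open>The annihilator of a binomial\<close>

text \<open>At the exponents \<open>pt s\<close> only the constant terms of the cofactors contribute, so the
  coefficient matrix factors through \<open>m\<close> dimensions.\<close>

lemma gen_ideal_relation:
  fixes g el :: "nat \<Rightarrow> 'a::field mpoly"
  assumes el: "\<And>t. t \<le> m \<Longrightarrow> el t \<in> gen_ideal n m g"
    and van: "\<And>f s r. f \<in> gen_ideal n m g \<Longrightarrow> s \<le> m \<Longrightarrow> r \<preceq> pt s \<Longrightarrow> r \<noteq> pt s \<Longrightarrow> lookup f r = 0"
  shows "\<exists>c. (\<exists>t\<le>m. c t \<noteq> 0) \<and> (\<forall>s\<le>m. (\<Sum>t\<le>m. c t * lookup (el t) (pt s)) = 0)"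
proof -
  have gI: "g i \<in> gen_ideal n m g" if "i < m" for i
  proof -
    have "g i = (\<Sum>j<m. (if j = i then 1 else 0) * g j)"
      using that by (simp add: if_distrib[of "\<lambda>x. x * _"] cong: if_cong)
    moreover have "\<forall>j<m. in_vars n (if j = i then 1 else 0 :: 'a mpoly)" by (simp add: in_vars_def)
    ultimately show ?thesis unfolding gen_ideal_def
      by (intro CollectI exI[of _ "\<lambda>j. if j = i then 1 else 0"]) auto
  qed
  have "\<exists>h. \<forall>t\<le>m. el t = (\<Sum>i<m. h t i * g i)"
    using el unfolding gen_ideal_def by (simp add: Ball_def) metis
  then obtain h where h: "\<And>t. t \<le> m \<Longrightarrow> el t = (\<Sum>i<m. h t i * g i)" by blast
  have lead: "lookup (f * g i) (pt s) = lookup f 0 * lookup (g i) (pt s)" if "i < m" "s \<le> m" for f i s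
  proof -
    have "lookup (g i * f) (pt s) = (\<Sum>q\<in>keys f. if q = 0 then lookup f 0 * lookup (g i) (pt s) else 0)"
      unfolding lookup_mult_sum
    proof (rule sum.cong[OF refl])
      fix q assume "q \<in> keys f"
      show "lookup f q * (if q \<preceq> pt s then lookup (g i) (pt s - q) else 0) =
        (if q = 0 then lookup f 0 * lookup (g i) (pt s) else 0)"
      proof (cases "q = 0")
        case True then show ?thesis by (simp add: mdvd_def)
      next
        case False
        have "lookup (g i) (pt s - q) = 0" if q: "q \<preceq> pt s"
        proof (rule van[OF gI[OF \<open>i < m\<close>] \<open>s \<le> m\<close>])
          show "pt s - q \<preceq> pt s" by (simp add: mdvd_def lookup_minus)
          show "pt s - q \<noteq> pt s" using mdvd_add_diff[OF q] False by (metis add_cancel_left_right)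
        qed
        then show ?thesis using False by simp
      qed
    qed
    also have "\<dots> = lookup f 0 * lookup (g i) (pt s)" by (auto simp: in_keys_iff)
    finally show ?thesis by (simp add: mult.commute)
  qed
  have "\<exists>c. (\<exists>t\<in>{..m}. c t \<noteq> 0) \<and> (\<forall>i\<in>{..<m}. (\<Sum>t\<in>{..m}. lookup (h t i) 0 * c t) = 0)"
    by (rule homogeneous_system) auto
  then obtain c where c: "\<exists>t\<le>m. c t \<noteq> 0" "\<And>i. i < m \<Longrightarrow> (\<Sum>t\<le>m. lookup (h t i) 0 * c t) = 0" by auto
  have "(\<Sum>t\<le>m. c t * lookup (el t) (pt s)) = 0" if s: "s \<le> m" for s
  proof -
    have "(\<Sum>t\<le>m. c t * lookup (el t) (pt s)) = (\<Sum>t\<le>m. \<Sum>i<m. c t * (lookup (h t i) 0 * lookup (g i) (pt s)))"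
      using s by (intro sum.cong refl) (simp add: h lookup_sum lead sum_distrib_left)
    also have "\<dots> = (\<Sum>i<m. (\<Sum>t\<le>m. lookup (h t i) 0 * c t) * lookup (g i) (pt s))"
      by (subst sum.swap) (simp add: sum_distrib_left ac_simps)
    also have "\<dots> = 0" using c(2) by simp
    finally show ?thesis .
  qed
  then show ?thesis using c(1) by blast
qed

locale binomial_dual =
  fixes n :: nat and a b :: "nat \<Rightarrow>\<^sub>0 nat" and c1 c2 :: "'a::field_char_0"
  assumes ne: "a \<noteq> b" and c1: "c1 \<noteq> 0" and c2: "c2 \<noteq> 0"
    and keys_a: "keys a \<subseteq> {..<n}" and keys_b: "keys b \<subseteq> {..<n}" and mdeg_eq: "mdeg a = mdeg b"
begin

definition F :: "'a mpoly" where "F = single a c1 + single b c2"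

text \<open>The constant coefficient of \<open>contract f F\<close>.\<close>

definition \<Phi> :: "'a mpoly \<Rightarrow> 'a" where "\<Phi> f = c1 * lookup f a + c2 * lookup f b"

abbreviation d :: nat where "d \<equiv> mdeg a"

abbreviation I :: "'a mpoly set" where "I \<equiv> Ann n F"

lemma \<Phi>_add: "\<Phi> (f + g) = \<Phi> f + \<Phi> g"
  by (simp add: \<Phi>_def lookup_add algebra_simps)

lemma \<Phi>_diff: "\<Phi> (f - g) = \<Phi> f - \<Phi> g"
  by (simp add: \<Phi>_def lookup_minus algebra_simps)

lemma \<Phi>_zero [simp]: "\<Phi> 0 = 0"
  by (simp add: \<Phi>_def)

lemma \<Phi>_sum: "\<Phi> (sum f A) = (\<Sum>i\<in>A. \<Phi> (f i))"
  by (induction A rule: infinite_finite_induct) (auto simp: \<Phi>_add)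

lemma \<Phi>_smult: "\<Phi> (single 0 c * f) = c * \<Phi> f"
  by (simp add: \<Phi>_def lookup_smult distrib_left mult.left_commute)

lemma \<Phi>_homog: "homog k f \<Longrightarrow> k \<noteq> d \<Longrightarrow> \<Phi> f = 0"
  unfolding \<Phi>_def by (metis homogD mdeg_eq mult_zero_right add_0)

lemma \<Phi>_not_mdvd: "\<not> q \<preceq> a \<Longrightarrow> \<not> q \<preceq> b \<Longrightarrow> \<Phi> (f * xp q) = 0"
  by (simp add: \<Phi>_def lookup_mult_xp)

lemma lookup_contract: "lookup (contract f F) c = \<Phi> (f * xp c)"
proof -
  have eq: "(\<Sum>p\<in>keys f. lookup f p * lookup F (p + c)) = \<Phi> (f * xp c)" for c
  proof -
    have "\<Phi> (f * xp c) = (\<Sum>p\<in>keys f. \<Phi> (single (p + c) (lookup f p)))"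
      by (subst mpoly_eq_sum[of f]) (simp add: sum_distrib_right mult_single \<Phi>_sum)
    also have "\<dots> = (\<Sum>p\<in>keys f. lookup f p * lookup F (p + c))"
      by (rule sum.cong) (auto simp: \<Phi>_def F_def lookup_add lookup_single when_def algebra_simps)
    finally show ?thesis by simp
  qed
  \<comment> \<open>\<open>contract\<close> is built with \<open>Abs_poly_mapping\<close>, so its
    coefficients can be read off only after its support is known to be finite.\<close>
  have "{c. \<Phi> (f * xp c) \<noteq> 0} \<subseteq> {c. c \<preceq> a} \<union> {c. c \<preceq> b}" using \<Phi>_not_mdvd by blast
  then have "finite {c. \<Phi> (f * xp c) \<noteq> 0}" using finite_mdvd finite_subset by blast
  then show ?thesis by (simp add: contract_def eq)
qed

lemma Ann_iff: "f \<in> I \<longleftrightarrow> in_vars n f \<and> (\<forall>q. \<Phi> (f * xp q) = 0)"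
  by (auto simp: Ann_def poly_mapping_eq_iff fun_eq_iff lookup_contract)

lemma \<Phi>_Ann: "f \<in> I \<Longrightarrow> \<Phi> (f * g) = 0"
proof -
  assume f: "f \<in> I"
  have "f * g = (\<Sum>q\<in>keys g. single 0 (lookup g q) * (f * xp q))"
    by (subst mpoly_eq_sum_xp[of g]) (simp add: sum_distrib_left ac_simps)
  then show ?thesis using f by (simp add: \<Phi>_sum \<Phi>_smult Ann_iff)
qed

lemma \<Phi>_Ann': "f \<in> I \<Longrightarrow> \<Phi> (g * f) = 0"
  using \<Phi>_Ann[of f g] by (simp add: mult.commute)

lemma Ann_mult: "f \<in> I \<Longrightarrow> in_vars n g \<Longrightarrow> g * f \<in> I"
  using \<Phi>_Ann[of f "g * _"] by (simp add: Ann_iff in_vars_mult mult.assoc mult.left_commute[of g f])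

lemma Ann_add: "f \<in> I \<Longrightarrow> g \<in> I \<Longrightarrow> f + g \<in> I"
  by (auto simp: Ann_iff in_vars_add \<Phi>_add distrib_right)

lemma Ann_diff: "f \<in> I \<Longrightarrow> g \<in> I \<Longrightarrow> f - g \<in> I"
  by (auto simp: Ann_iff in_vars_minus \<Phi>_diff left_diff_distrib)

lemma Ann_zero: "0 \<in> I"
  by (simp add: Ann_iff)

lemma Ann_sum: "(\<And>i. i \<in> A \<Longrightarrow> f i \<in> I) \<Longrightarrow> sum f A \<in> I"
  by (induction A rule: infinite_finite_induct) (auto intro: Ann_add Ann_zero)

text \<open>Only multipliers of complementary degree can reach \<open>a\<close> or \<open>b\<close>,
  and a multiplier with a foreign variable divides neither.\<close>

lemma Ann_homogI:
  assumes "in_vars n f" "homog k f"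
    and "\<And>q. keys q \<subseteq> {..<n} \<Longrightarrow> mdeg q + k = d \<Longrightarrow> \<Phi> (f * xp q) = 0"
  shows "f \<in> I"
  unfolding Ann_iff
proof (intro conjI allI)
  fix q show "\<Phi> (f * xp q) = 0"
  proof (cases "keys q \<subseteq> {..<n} \<and> mdeg q + k = d")
    case False
    show ?thesis
    proof (cases "keys q \<subseteq> {..<n}")
      case True
      then have "k + mdeg q \<noteq> d" using False by auto
      then show ?thesis using \<Phi>_homog[OF homog_mult[OF assms(2) homog_single[of q "mdeg q" 1]]] by simp
    next
      case False
      then have "\<not> q \<preceq> a" "\<not> q \<preceq> b" using mdvd_keys keys_a keys_b by blast+
      then show ?thesis by (rule \<Phi>_not_mdvd)
    qed
  qed (use assms in auto)
qed (use assms in auto)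

lemma Ann_xp: "keys p \<subseteq> {..<n} \<Longrightarrow> \<not> p \<preceq> a \<Longrightarrow> \<not> p \<preceq> b \<Longrightarrow> xp p \<in> I"
  unfolding Ann_iff using \<Phi>_not_mdvd[of p] by (auto simp: in_vars_single mult.commute[of "xp p"])

text \<open>Testing with a cofactor \<open>q\<close> sees only the coefficients that
  \<open>q\<close> lifts to \<open>a\<close> and to \<open>b\<close>. If one of the two does not
  exist, the other must vanish, as in the two lemmas that follow.\<close>

lemma Ann_relation: "f \<in> I \<Longrightarrow> r + q = a \<Longrightarrow> s + q = b \<Longrightarrow> c1 * lookup f r + c2 * lookup f s = 0"
  using \<Phi>_Ann[of f "xp q"] unfolding \<Phi>_def by (metis lookup_mult_xp_add)

lemma Ann_vanish_a: "f \<in> I \<Longrightarrow> r + q = a \<Longrightarrow> \<not> q \<preceq> b \<Longrightarrow> lookup f r = 0"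
  using \<Phi>_Ann[of f "xp q"] lookup_mult_xp_add[of f q r] c1 by (simp add: \<Phi>_def lookup_mult_xp_not_mdvd)

lemma Ann_vanish_b: "f \<in> I \<Longrightarrow> r + q = b \<Longrightarrow> \<not> q \<preceq> a \<Longrightarrow> lookup f r = 0"
  using \<Phi>_Ann[of f "xp q"] lookup_mult_xp_add[of f q r] c2 by (simp add: \<Phi>_def lookup_mult_xp_not_mdvd)

text \<open>Telescoping: a multiplier lifts \<open>ps k\<close> to \<open>a\<close> exactly when it
  lifts \<open>ps (Suc k)\<close> to \<open>b\<close>, and the ratio \<open>- c1 / c2\<close>
  cancels the two contributions. The end conditions rule out the two unpaired ones.\<close>

lemma Ann_chain:
  assumes vars: "\<And>k. k \<le> m \<Longrightarrow> keys (ps k) \<subseteq> {..<n}"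
    and step: "\<And>k. k < m \<Longrightarrow> ps (Suc k) + a = ps k + b"
    and start: "\<not> ps 0 \<preceq> b" and last: "\<not> ps m \<preceq> a"
  shows "(\<Sum>k\<le>m. single (ps k) ((- c1 / c2) ^ k)) \<in> I"
  unfolding Ann_iff
proof (intro conjI allI)
  show "in_vars n (\<Sum>k\<le>m. single (ps k) ((- c1 / c2) ^ k))"
    by (intro in_vars_sum in_vars_single vars) simp
  fix q
  define A where "A k = (if ps k + q = a then 1 else 0 :: 'a)" for k
  define B where "B k = (if ps k + q = b then 1 else 0 :: 'a)" for k
  let ?r = "- c1 / c2"
  have AB: "B (Suc k) = A k" if "k < m" for k
  proof -
    have "ps (Suc k) + q + a = ps k + q + b" using step[OF that] by (metis add.commute add.left_commute)
    then have "ps (Suc k) + q = b \<longleftrightarrow> ps k + q = a" by (metis add.commute add_left_imp_eq)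
    then show ?thesis by (simp add: A_def B_def)
  qed
  have "B 0 = 0" using start by (auto simp: B_def mdvd_iff_add add.commute)
  have "A m = 0" using last by (auto simp: A_def mdvd_iff_add add.commute)
  have "\<Phi> ((\<Sum>k\<le>m. single (ps k) (?r ^ k)) * xp q) = (\<Sum>k\<le>m. ?r ^ k * (c1 * A k) + ?r ^ k * (c2 * B k))"
    unfolding sum_distrib_right \<Phi>_sum
    by (rule sum.cong) (auto simp: mult_single \<Phi>_def lookup_single when_def A_def B_def)
  also have "\<dots> = (\<Sum>k\<le>m. ?r ^ k * (c1 * A k)) + (\<Sum>k\<le>m. ?r ^ k * (c2 * B k))"
    by (rule sum.distrib)
  also have "(\<Sum>k\<le>m. ?r ^ k * (c1 * A k)) = (\<Sum>k<m. ?r ^ k * (c1 * A k))"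
    using \<open>A m = 0\<close> by (simp add: lessThan_Suc_atMost[symmetric])
  also have "(\<Sum>k\<le>m. ?r ^ k * (c2 * B k)) = (\<Sum>k<m. ?r ^ Suc k * (c2 * B (Suc k)))"
    using \<open>B 0 = 0\<close> by (simp add: sum.atMost_shift)
  also have "\<dots> = (\<Sum>k<m. - (?r ^ k * (c1 * A k)))"
    using c2 by (intro sum.cong) (auto simp: AB field_simps)
  finally show "\<Phi> ((\<Sum>k\<le>m. single (ps k) (?r ^ k)) * xp q) = 0" by (simp add: sum_negf)
qed

text \<open>The pairing \<open>\<Phi> (f * g)\<close> makes the quotient self-dual, so surjectivity in the upper
  half is the transpose of injectivity in the lower half.\<close>

lemma SLP_if_injective:
  assumes L: "in_vars n L" "homog 1 L"
    and inj: "\<And>i f. 2 * i \<le> d \<Longrightarrow> in_vars n f \<Longrightarrow> homog i f \<Longrightarrow> L ^ (d - 2 * i) * f \<in> I \<Longrightarrow> f \<in> I"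
  shows "SLP n I"
  unfolding SLP_def
proof (intro exI[of _ L] conjI allI impI L)
  have Lk: "in_vars n (L ^ k)" "homog k (L ^ k)" for k
    using in_vars_power[OF L(1)] homog_power[OF L(2), of k] by auto
  \<comment> \<open>Lower powers are injective too: multiply by the missing power of
    \<open>L\<close>.\<close>
  have injk: "f \<in> I" if "2 * i + k \<le> d" "in_vars n f" "homog i f" "L ^ k * f \<in> I" for i k f
  proof (rule inj[of i])
    have "L ^ (d - 2 * i - k) * (L ^ k * f) \<in> I" by (rule Ann_mult[OF that(4) Lk(1)])
    moreover have "L ^ (d - 2 * i - k) * (L ^ k * f) = L ^ (d - 2 * i) * f"
      using that by (simp add: mult.assoc[symmetric] power_add[symmetric])
    ultimately show "L ^ (d - 2 * i) * f \<in> I" by (simp only:)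
  qed (use that in auto)
  fix i k :: nat
  show "(\<forall>f. in_vars n f \<and> homog i f \<and> L ^ k * f \<in> I \<longrightarrow> f \<in> I) \<or>
    (\<forall>g. in_vars n g \<and> homog (i + k) g \<longrightarrow> (\<exists>f. in_vars n f \<and> homog i f \<and> g - L ^ k * f \<in> I))"
  proof (cases "2 * i + k \<le> d")
    case True
    then show ?thesis using injk by blast
  next
    case False
    have "\<exists>f. in_vars n f \<and> homog i f \<and> g - L ^ k * f \<in> I" if g: "in_vars n g" "homog (i + k) g" for g
    proof (cases "i + k \<le> d")
      case gt: False
      have "g \<in> I" by (rule Ann_homogI[OF g]) (use gt in auto)
      then show ?thesis by (intro exI[of _ 0]) simp
    next
      case le: True
      define Q where "Q = {q. keys q \<subseteq> {..<n} \<and> mdeg q = d - (i + k)}"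
      define V where "V = {f :: 'a mpoly. in_vars n f \<and> homog i f}"
      have "\<exists>f\<in>V. \<forall>q\<in>Q. \<Phi> (L ^ k * f * xp q) = \<Phi> (g * xp q)"
      proof (rule fredholm_alternative)
        show "finite Q" unfolding Q_def by (rule finite_mdeg_vars)
        show "msubspace V" unfolding msubspace_def V_def
          by (auto intro: in_vars_add homog_add in_vars_mult homog_smult)
        show "mlinear (\<lambda>f. \<Phi> (L ^ k * f * xp q))" for q
          unfolding mlinear_def using \<Phi>_smult[of _ "L ^ k * _ * xp q"]
          by (auto simp: \<Phi>_add algebra_simps)
        fix l assume l: "\<And>f. f \<in> V \<Longrightarrow> (\<Sum>q\<in>Q. l q * \<Phi> (L ^ k * f * xp q)) = 0"
        \<comment> \<open>A relation \<open>l\<close> among the test functionals is a form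
          \<open>h\<close> such that \<open>L ^ k * h\<close> is orthogonal to all forms of degree
          \<open>i\<close>. Its degree \<open>d - (i + k)\<close> is small enough for injectivity,
          so \<open>h\<close> lies in \<open>I\<close>.\<close>
        define h where "h = (\<Sum>q\<in>Q. single q (l q))"
        have h_eq: "\<Phi> (f * h) = (\<Sum>q\<in>Q. l q * \<Phi> (f * xp q))" for f
        proof -
          have "f * h = (\<Sum>q\<in>Q. single 0 (l q) * (f * xp q))"
            unfolding h_def by (simp add: sum_distrib_left mult.left_commute[of _ f] mult_single)
          then show ?thesis by (simp add: \<Phi>_sum \<Phi>_smult)
        qed
        have hv: "in_vars n h" "homog (d - (i + k)) h"
          unfolding h_def by (intro in_vars_sum homog_sum in_vars_single homog_single; simp add: Q_def)+
        have "L ^ k * h \<in> I"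
        proof (rule Ann_homogI[of _ "k + (d - (i + k))"])
          fix q assume q: "keys q \<subseteq> {..<n}" "mdeg q + (k + (d - (i + k))) = d"
          then have "xp q \<in> V" using le by (auto simp: V_def in_vars_single homog_single)
          then have "\<Phi> (L ^ k * xp q * h) = 0" using l[of "xp q"] h_eq by simp
          then show "\<Phi> (L ^ k * h * xp q) = 0" by (simp add: ac_simps)
        qed (use Lk hv in \<open>auto intro: in_vars_mult homog_mult\<close>)
        then have "h \<in> I" using False le hv by (intro injk[of "d - (i + k)" k h]) auto
        then show "(\<Sum>q\<in>Q. l q * \<Phi> (g * xp q)) = 0"
          using \<Phi>_Ann'[of h g] h_eq by simp
      qed
      then obtain f where f: "in_vars n f" "homog i f" "\<And>q. q \<in> Q \<Longrightarrow> \<Phi> (L ^ k * f * xp q) = \<Phi> (g * xp q)"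
        by (auto simp: V_def)
      have "g - L ^ k * f \<in> I"
      proof (rule Ann_homogI[of _ "i + k"])
        show "homog (i + k) (g - L ^ k * f)"
          using homog_mult[OF Lk(2)[of k] f(2)] g(2) by (intro homog_minus) (auto simp: add.commute)
        fix q assume "keys q \<subseteq> {..<n}" "mdeg q + (i + k) = d"
        then have "q \<in> Q" by (auto simp: Q_def)
        then show "\<Phi> ((g - L ^ k * f) * xp q) = 0" using f(3) by (simp add: left_diff_distrib \<Phi>_diff)
      qed (use g f Lk in \<open>auto intro: in_vars_minus in_vars_mult\<close>)
      then show ?thesis using f by blast
    qed
    then show ?thesis by blast
  qed
qed

end


subsection \<open>Binomials whose annihilator is a complete intersection\<close>

lemma lookup_scale: "lookup (Poly_Mapping.map ((*) (k::nat)) p) j = k * lookup p j"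
  by (simp add: Poly_Mapping.map.rep_eq when_def)

lemma lookup_eq_0_if_not_key: "keys p \<subseteq> {..<n} \<Longrightarrow> \<not> j < n \<Longrightarrow> lookup p j = (0::nat)"
  by (auto simp: in_keys_iff)

lemma keys_subset_if: "(\<And>j. lookup p j \<noteq> 0 \<Longrightarrow> j < n) \<Longrightarrow> keys p \<subseteq> {..<n}"
  by (auto simp: in_keys_iff)

context binomial_dual
begin

abbreviation U :: "nat set" where "U \<equiv> {i. lookup b i < lookup a i}"
abbreviation V :: "nat set" where "V \<equiv> {i. lookup a i < lookup b i}"

abbreviation M :: "nat \<Rightarrow> nat" where "M j \<equiv> max (lookup a j) (lookup b j)"

lemma U_nonempty: "U \<noteq> {}"
proof
  assume "U = {}"
  then have "a \<preceq> b" by (auto simp: mdvd_def not_less)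
  then show False using mdvd_mdeg_eq mdeg_eq ne by blast
qed

lemma V_nonempty: "V \<noteq> {}"
proof
  assume "V = {}"
  then have "b \<preceq> a" by (auto simp: mdvd_def not_less)
  then show False using mdvd_mdeg_eq mdeg_eq ne by metis
qed

lemma UV_vars: "i \<in> U \<Longrightarrow> i < n" "i \<in> V \<Longrightarrow> i < n"
  using lookup_eq_0_if_not_key[OF keys_a, of i] lookup_eq_0_if_not_key[OF keys_b, of i] by auto

lemma pure_power_Ann: "j < n \<Longrightarrow> xp (single j (Suc (M j))) \<in> I"
  by (rule Ann_xp) (auto simp: mdvd_def intro!: exI[of _ j])

text \<open>A power of \<open>j\<close> up to \<open>M j\<close> divides whichever of
  \<open>X\<^sup>a\<close> and \<open>X\<^sup>b\<close> has the larger exponent at \<open>j\<close>.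
  Its cofactor keeps the full exponent at \<open>i\<close> or \<open>i'\<close>, so it does not
  divide the other monomial. With \<open>pure_power_Ann\<close>, the pure power is a minimal
  generator.\<close>

lemma pure_power_vanish:
  assumes "i \<in> U" "i \<noteq> j" "i' \<in> V" "i' \<noteq> j" "f \<in> I"
    and r: "r \<preceq> single j (Suc (M j))" "r \<noteq> single j (Suc (M j))"
  shows "lookup f r = 0"
proof -
  have r0: "lookup r k = 0" if "k \<noteq> j" for k
    using r(1) that by (auto simp: mdvd_def lookup_single when_def split: if_splits)
  have "lookup r j \<le> Suc (M j)" using r(1) by (metis mdvd_def lookup_single_eq)
  moreover have "lookup r j \<noteq> Suc (M j)"
  proof
    assume "lookup r j = Suc (M j)"
    then have "r = single j (Suc (M j))" using r0
      by (intro poly_mapping_eqI) (auto simp: lookup_single when_def)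
    then show False using r by simp
  qed
  ultimately have rj: "lookup r j \<le> M j" by simp
  show ?thesis
  proof (cases "lookup b j \<le> lookup a j")
    case True
    have "r \<preceq> a" using r0 rj True by (auto simp: mdvd_def) (metis le0 max.absorb1)
    then have "r + (a - r) = a" using mdvd_add_diff by (metis add.commute)
    moreover have "\<not> a - r \<preceq> b" using assms(1,2) r0[of i]
      by (auto simp: mdvd_def lookup_minus not_le intro!: exI[of _ i])
    ultimately show ?thesis using Ann_vanish_a assms(5) by blast
  next
    case False
    have "r \<preceq> b" using r0 rj False by (auto simp: mdvd_def) (metis le0 max.absorb2 nat_le_linear)
    then have "r + (b - r) = b" using mdvd_add_diff by (metis add.commute)
    moreover have "\<not> b - r \<preceq> a" using assms(3,4) r0[of i']
      by (auto simp: mdvd_def lookup_minus not_le intro!: exI[of _ i'])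
    ultimately show ?thesis using Ann_vanish_b assms(5) by blast
  qed
qed

text \<open>In degree \<open>d\<close> the annihilator is the kernel of \<open>\<Phi>\<close>. This
  element ensures that some exponent bounded by \<open>M\<close> occurs in the annihilator.\<close>

lemma swap_binomial_Ann: "single a c2 + single b (- c1) \<in> I"
proof (rule Ann_homogI[of _ d])
  show "in_vars n (single a c2 + single b (- c1))"
    using keys_a keys_b by (intro in_vars_add in_vars_single)
  show "homog d (single a c2 + single b (- c1))"
    using mdeg_eq by (intro homog_add homog_single) auto
  fix q assume "mdeg q + d = d"
  then have "q = 0" using mdvd_mdeg_eq[of 0 q] by (simp add: mdvd_def)
  then show "\<Phi> ((single a c2 + single b (- c1)) * xp q) = 0"
    using ne by (simp add: \<Phi>_def lookup_add lookup_single when_def)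
qed

text \<open>The \<open>n\<close> pure powers are minimal generators, and a further one involves an
  exponent inside the box given by \<open>M\<close>.\<close>

lemma not_CI_if_two_two:
  assumes "i1 \<in> U" "i2 \<in> U" "i1 \<noteq> i2" "j1 \<in> V" "j2 \<in> V" "j1 \<noteq> j2"
  shows "I \<noteq> gen_ideal n n g"
proof
  assume gen: "I = gen_ideal n n g"
  \<comment> \<open>The box is closed under divisors, so no proper divisor of an exponent of least
    degree in \<open>S\<close> occurs in the annihilator.\<close>
  define S where "S = {p. (\<forall>i. lookup p i \<le> M i) \<and> (\<exists>f\<in>I. lookup f p \<noteq> 0)}"
  have "a \<in> S" using swap_binomial_Ann ne c2
    by (auto simp: S_def lookup_add lookup_single when_def intro!: bexI[of _ "single a c2 + single b (- c1)"])
  then obtain p where p: "p \<in> S" "\<And>r. r \<in> S \<Longrightarrow> mdeg p \<le> mdeg r"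
    using ex_has_least_nat[of "\<lambda>p. p \<in> S" a mdeg] by blast
  then obtain f where f: "f \<in> I" "lookup f p \<noteq> 0" and pM: "\<And>i. lookup p i \<le> M i" by (auto simp: S_def)
  define el where "el t = (if t = n then f else xp (single t (Suc (M t))))" for t
  define pt where "pt t = (if t = n then p else single t (Suc (M t)))" for t
  have "\<exists>c. (\<exists>t\<le>n. c t \<noteq> 0) \<and> (\<forall>s\<le>n. (\<Sum>t\<le>n. c t * lookup (el t) (pt s)) = 0)"
  proof (rule gen_ideal_relation)
    show "el t \<in> gen_ideal n n g" if "t \<le> n" for t
      using that f pure_power_Ann[of t] unfolding gen[symmetric] by (auto simp: el_def)
    fix h s r assume h: "h \<in> gen_ideal n n g" "s \<le> n" "r \<preceq> pt s" "r \<noteq> pt s"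
    have hI: "h \<in> I" using h gen by simp
    show "lookup h r = 0"
    proof (cases "s = n")
      case True
      then have r: "r \<preceq> p" "r \<noteq> p" using h by (auto simp: pt_def)
      then have "mdeg r < mdeg p" using mdvd_mdeg[of r p] mdvd_mdeg_eq[of r p] by linarith
      then have "r \<notin> S" using p by force
      moreover have "\<forall>i. lookup r i \<le> M i" using r pM unfolding mdvd_def by (meson order_trans)
      ultimately show ?thesis using hI unfolding S_def by blast
    next
      case False
      obtain i where "i \<in> U" "i \<noteq> s" using assms by metis
      moreover obtain i' where "i' \<in> V" "i' \<noteq> s" using assms by metis
      ultimately show ?thesis using pure_power_vanish hI h False by (auto simp: pt_def)
    qed
  qed
  then obtain c where c: "\<exists>t\<le>n. c t \<noteq> 0" "\<And>s. s \<le> n \<Longrightarrow> (\<Sum>t\<le>n. c t * lookup (el t) (pt s)) = 0" by blast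
  \<comment> \<open>The pure powers lie outside the box, so the row at \<open>p\<close> isolates the
    coefficient of \<open>f\<close>; the other rows then separate the pure powers.\<close>
  have "lookup (el t) p = 0" if "t \<noteq> n" for t
    using pM[of t] that by (auto simp: el_def lookup_single when_def)
  then have "(\<Sum>t\<le>n. c t * lookup (el t) (pt n)) = (\<Sum>t\<le>n. if t = n then c n * lookup f p else 0)"
    by (intro sum.cong) (auto simp: pt_def el_def)
  then have cn: "c n = 0" using c(2)[of n] f by simp
  have "c s = 0" if s: "s < n" for s
  proof -
    have ss: "single t (Suc x) = single s (Suc y) \<longleftrightarrow> t = s \<and> x = y" for t x y :: nat
      by (auto simp: poly_mapping_eq_iff fun_eq_iff lookup_single when_def split: if_splits)
    have "(\<Sum>t\<le>n. c t * lookup (el t) (pt s)) = (\<Sum>t\<le>n. if t = s then c s else 0)"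
      using s cn by (intro sum.cong) (auto simp: pt_def el_def lookup_single when_def ss)
    then show ?thesis using c(2)[of s] s by simp
  qed
  then show False using c(1) cn by (metis le_neq_implies_less)
qed

end

section \<open>Exchange chains when \<open>a\<close> exceeds \<open>b\<close> in one variable
  only\<close>

locale binomial_dual_single = binomial_dual n a b c1 c2
  for n a b and c1 c2 :: "'a::field_char_0" +
  fixes i0 :: nat
  assumes U_single: "{i. lookup b i < lookup a i} = {i0}"
begin

abbreviation g :: nat where "g \<equiv> lookup b i0"
abbreviation u :: nat where "u \<equiv> lookup a i0 - lookup b i0"

lemma u_pos: "0 < u" and a_i0: "lookup a i0 = g + u"
  using U_single by auto

lemma i0_less: "i0 < n"
  using UV_vars(1) U_single by auto

lemma a_le_b: "j \<noteq> i0 \<Longrightarrow> lookup a j \<le> lookup b j"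
  using U_single by (metis (mono_tags) mem_Collect_eq not_less singletonD)

text \<open>The chain \<open>w + (g + 1) e\<^sub>i\<^sub>0 + k (b - a)\<close>; the truncated subtractions are exact as long as
  \<open>k * u \<le> g + 1\<close>.\<close>

definition ps :: "(nat \<Rightarrow>\<^sub>0 nat) \<Rightarrow> nat \<Rightarrow> nat \<Rightarrow>\<^sub>0 nat" where
  "ps w k = single i0 (Suc g - k * u) + Poly_Mapping.map ((*) k) (b - a) + w"

lemma lookup_ps: "lookup w i0 = 0 \<Longrightarrow> lookup (ps w k) j =
    (if j = i0 then Suc g - k * u else k * (lookup b j - lookup a j) + lookup w j)"
  using a_i0 by (simp add: ps_def lookup_add lookup_scale lookup_minus lookup_single when_def)

lemma ps_step:
  assumes "lookup w i0 = 0" "Suc k * u \<le> Suc g"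
  shows "ps w (Suc k) + a = ps w k + b"
proof (rule poly_mapping_eqI)
  fix j show "lookup (ps w (Suc k) + a) j = lookup (ps w k + b) j"
    using assms a_i0 a_le_b[of j] by (cases "j = i0") (auto simp: lookup_add lookup_ps)
qed

lemma mult_u_mono: "k \<le> m \<Longrightarrow> m * u \<le> Suc g \<Longrightarrow> k * u \<le> Suc g"
  by (meson le_trans mult_le_mono1)

text \<open>The start has exponent \<open>g + 1\<close> at \<open>i0\<close> and cannot divide
  \<open>b\<close>; the end overshoots \<open>a\<close> at \<open>j\<close>.\<close>

lemma chain_Ann:
  assumes w: "lookup w i0 = 0" "keys w \<subseteq> {..<n}" and m: "m * u \<le> Suc g"
    and j: "j \<noteq> i0" "lookup a j < m * (lookup b j - lookup a j) + lookup w j"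
  shows "(\<Sum>k\<le>m. single (ps w k) ((- c1 / c2) ^ k)) \<in> I"
proof (rule Ann_chain)
  show "keys (ps w k) \<subseteq> {..<n}" for k
  proof (rule keys_subset_if)
    fix j assume nz: "lookup (ps w k) j \<noteq> 0"
    show "j < n"
    proof (rule ccontr)
      assume "\<not> j < n"
      then show False
        using nz lookup_eq_0_if_not_key[OF keys_b, of j] lookup_eq_0_if_not_key[OF w(2), of j] i0_less
        by (auto simp: lookup_ps[OF w(1)] split: if_splits)
    qed
  qed
  show "ps w (Suc k) + a = ps w k + b" if "k < m" for k
    by (rule ps_step[OF w(1)]) (rule mult_u_mono[OF _ m], use that in simp)
  show "\<not> ps w 0 \<preceq> b"
    by (auto simp: mdvd_def lookup_ps[OF w(1)] intro!: exI[of _ i0])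
  show "\<not> ps w m \<preceq> a"
    using j by (auto simp: mdvd_def lookup_ps[OF w(1)] intro!: exI[of _ j])
qed

text \<open>Descent along the chain. With \<open>m\<close> the last step that the exponent of
  \<open>i0\<close> permits, the cofactor of the end in \<open>a\<close> has exponent above
  \<open>g\<close> at \<open>i0\<close>, so it does not divide \<open>b\<close>. Each earlier
  coefficient is proportional to the next one.\<close>

lemma chain_vanish:
  assumes w: "lookup w i0 = 0" and m: "m * u \<le> Suc g" "Suc g < Suc m * u"
    and wj: "\<And>j. j \<noteq> i0 \<Longrightarrow> m * (lookup b j - lookup a j) + lookup w j \<le> lookup a j"
    and f: "f \<in> I" and k: "k \<le> m"
  shows "lookup f (ps w k) = 0"
  using k
proof (induction k rule: inc_induct)
  have le: "ps w k \<preceq> a" if "k \<le> m" for k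
    unfolding mdvd_def
  proof
    fix j
    have km: "k * (lookup b j - lookup a j) \<le> m * (lookup b j - lookup a j)"
      by (rule mult_le_mono1[OF that])
    show "lookup (ps w k) j \<le> lookup a j"
    proof (cases "j = i0")
      case True
      then show ?thesis using a_i0 u_pos by (simp add: lookup_ps[OF w])
    next
      case False
      then show ?thesis unfolding lookup_ps[OF w] if_not_P[OF False] using km wj[OF False] by linarith
    qed
  qed
  {
    case base
    have "\<not> a - ps w m \<preceq> b"
      using m a_i0 u_pos by (auto simp: mdvd_def lookup_minus lookup_ps[OF w] intro!: exI[of _ i0])
    then show ?case
      using Ann_vanish_a[OF f, of "ps w m" "a - ps w m"] mdvd_add_diff[OF le[of m]] by (simp add: add.commute)
  next
    case (step k)
    have 1: "ps w k + (a - ps w k) = a" using mdvd_add_diff[OF le[of k]] step by (simp add: add.commute)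
    have "ps w (Suc k) + a = ps w k + b"
      by (rule ps_step[OF w]) (rule mult_u_mono[OF _ m(1)], use step in simp)
    then have "ps w k + (ps w (Suc k) + (a - ps w k)) = ps w k + b" using 1 by (metis add.left_commute)
    then have 2: "ps w (Suc k) + (a - ps w k) = b" by simp
    show ?case using Ann_relation[OF f 1 2] step.IH c1 by simp
  }
qed

text \<open>If the chain from the bare power of \<open>i0\<close> still divides
  \<open>X\<^sup>a\<close> when that power is exhausted, an extra factor in some \<open>j\<close> of
  \<open>V\<close> is needed to end it. Two choices of \<open>j\<close> and the \<open>n - 1\<close>
  pure powers other than that of \<open>i0\<close> give \<open>n + 1\<close> minimal
  generators.\<close>

lemma short_chain_if_CI:
  assumes gen: "I = gen_ideal n n gs" and j12: "j1 \<in> V" "j2 \<in> V" "j1 \<noteq> j2"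
  shows "\<exists>m j. j \<in> V \<and> m * u \<le> Suc g \<and> lookup a j < m * (lookup b j - lookup a j)"
proof (rule ccontr)
  assume neg: "\<not> ?thesis"
  \<comment> \<open>The number of exchange steps that the exponent \<open>g + 1\<close> of
    \<open>i0\<close> permits.\<close>
  define m where "m = Suc g div u"
  have m: "m * u \<le> Suc g" "Suc g < Suc m * u"
    using dividend_less_div_times[OF u_pos, of "Suc g"] by (simp_all only: m_def mult_Suc div_times_less_eq_dividend)
  have mv: "m * (lookup b j - lookup a j) \<le> lookup a j" for j
  proof (cases "j \<in> V")
    case True
    then have "\<not> lookup a j < m * (lookup b j - lookup a j)" using neg m(1) by blast
    then show ?thesis by (simp only: not_less)
  qed simp
  \<comment> \<open>The least exponent of \<open>j\<close> at the start that pushes the end of the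
    chain past \<open>lookup a j\<close>.\<close>
  define w where "w j = lookup a j + 1 - m * (lookup b j - lookup a j)" for j
  have w_pos: "0 < w j" and w_eq: "m * (lookup b j - lookup a j) + w j = lookup a j + 1" for j
    using mv[of j] by (auto simp: w_def)
  have Vi0: "j \<noteq> i0" if "j \<in> V" for j using that U_single by auto
  define P where "P j = ps (single j (w j)) 0" for j
  define E where "E j = (\<Sum>k\<le>m. single (ps (single j (w j)) k) ((- c1 / c2) ^ k))" for j
  have ws: "lookup (single j x) i0 = 0" if "j \<in> V" for j x
    using Vi0[OF that] by (simp add: lookup_single)
  have lkP: "lookup (P j) k = (if k = i0 then Suc g else if k = j then w j else 0)" if "j \<in> V" for j k
    by (simp add: P_def lookup_ps[OF ws[OF that]] lookup_single when_def)
  have E: "E j \<in> I" if "j \<in> V" for j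
    unfolding E_def using Vi0[OF that] UV_vars(2)[OF that] w_pos w_eq[of j]
    by (intro chain_Ann[where j = j] ws that m) (auto simp: lookup_single)
  \<comment> \<open>If \<open>r\<close> has the full power of \<open>i0\<close>, it starts a chain
    that stays inside \<open>a\<close>. Otherwise it divides \<open>b\<close>, and its cofactor
    keeps the exponent at \<open>j'\<close>, which is larger than that of \<open>a\<close>.\<close>
  have P_van: "lookup f r = 0" if j: "j \<in> V" "j' \<in> V" "j \<noteq> j'" and f: "f \<in> I" and r: "r \<preceq> P j" "r \<noteq> P j" for j j' f r
  proof (cases "lookup r i0 = Suc g")
    case True
    have r0: "lookup r k = 0" if "k \<noteq> i0" "k \<noteq> j" for k
      using r(1) that lkP[OF j(1), of k] by (metis mdvd_def le_zero_eq)
    have rps: "r = ps (single j (lookup r j)) 0"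
      using True r0 by (intro poly_mapping_eqI) (auto simp: lookup_ps[OF ws[OF j(1)]] lookup_single when_def)
    have rw: "lookup r j < w j"
    proof -
      have "lookup r j \<le> w j" using r(1) lkP[OF j(1), of j] Vi0[OF j(1)] by (metis mdvd_def)
      moreover have "lookup r j \<noteq> w j" using calculation r(2) P_def rps by metis
      ultimately show ?thesis by simp
    qed
    have "m * (lookup b k - lookup a k) + lookup (single j (lookup r j)) k \<le> lookup a k" for k
    proof (cases "k = j")
      case True
      then show ?thesis using rw w_eq[of j] by simp
    next
      case False
      then show ?thesis using mv[of k] by (simp add: lookup_single_not_eq)
    qed
    then show ?thesis using chain_vanish[OF ws[OF j(1)] m _ f, of "lookup r j" 0] rps by simp
  next
    case False
    have rP: "lookup r k \<le> lookup (P j) k" for k using r(1) by (simp add: mdvd_def)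
    have "r \<preceq> b"
      unfolding mdvd_def
    proof
      fix k
      show "lookup r k \<le> lookup b k"
        using rP[of k] False lkP[OF j(1), of k] w_eq[of j] j(1) by (auto split: if_splits)
    qed
    then have "r + (b - r) = b" using mdvd_add_diff by (metis add.commute)
    moreover have "\<not> b - r \<preceq> a"
      using rP[of j'] lkP[OF j(1), of j'] j Vi0[OF j(2)]
      by (auto simp: mdvd_def lookup_minus not_le intro!: exI[of _ j'])
    ultimately show ?thesis using Ann_vanish_b f by blast
  qed
  \<comment> \<open>The vanishing argument for a pure power needs an index of \<open>U\<close>
    different from its variable, which fails for \<open>i0\<close>. Its slot and the extra slot
    \<open>n\<close> hold the two chain elements.\<close>
  define el where "el t = (if t = n then E j2 else if t = i0 then E j1 else xp (single t (Suc (M t))))" for t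
  define pt where "pt t = (if t = n then P j2 else if t = i0 then P j1 else single t (Suc (M t)))" for t
  have EP: "lookup (E j) (P j') = (if j = j' then 1 else 0)" if j: "j \<in> V" "j' \<in> V" for j j'
  proof -
    have "ps (single j (w j)) k = P j' \<longleftrightarrow> k = 0 \<and> j = j'" if k: "k \<le> m" for k
    proof
      assume eq: "ps (single j (w j)) k = P j'"
      have "Suc g - k * u = Suc g"
        using arg_cong[OF eq, of "\<lambda>p. lookup p i0"] lkP[OF j(2), of i0] lookup_ps[OF ws[OF j(1)]] by simp
      then have "k * u = 0" by linarith
      then have k0: "k = 0" using u_pos by auto
      moreover have "lookup (P j) j = lookup (P j') j" using eq k0 by (simp add: P_def)
      then have "j = j'" using w_pos[of j] lkP[OF j(1), of j] lkP[OF j(2), of j] Vi0[OF j(1)] by (auto split: if_splits)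
      ultimately show "k = 0 \<and> j = j'" by simp
    qed (simp add: P_def)
    then have "lookup (E j) (P j') = (\<Sum>k\<le>m. if k = 0 then (if j = j' then 1 else 0) else 0)"
      unfolding E_def lookup_sum by (intro sum.cong) (auto simp: lookup_single when_def)
    then show ?thesis by simp
  qed
  have E_pure: "lookup (E j) (single s (Suc (M s))) = 0" if j: "j \<in> V" and s: "s \<noteq> i0" for j s
  proof -
    have "ps (single j (w j)) k \<noteq> single s (Suc (M s))" if k: "k \<le> m" for k
    proof
      assume eq: "ps (single j (w j)) k = single s (Suc (M s))"
      have ks: "k * (lookup b s - lookup a s) + lookup (single j (w j)) s = Suc (M s)"
        using arg_cong[OF eq, of "\<lambda>p. lookup p s"] lookup_ps[OF ws[OF j]] s by simp
      have km: "k * (lookup b s - lookup a s) \<le> m * (lookup b s - lookup a s)" by (rule mult_le_mono1[OF k])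
      have Ms: "lookup a s \<le> M s" "lookup b s \<le> M s" by simp_all
      show False
      proof (cases "s = j")
        case True
        have "lookup a s < lookup b s" using j True by simp
        moreover have "lookup (single j (w j)) s = w s" using True by simp
        ultimately show False using ks km Ms w_eq[of s] by linarith
      next
        case False
        then have "lookup (single j (w j)) s = 0" by (simp add: lookup_single_not_eq)
        then show False using ks km Ms mv[of s] by linarith
      qed
    qed
    then show ?thesis unfolding E_def lookup_sum
      by (intro sum.neutral) (auto simp: lookup_single when_def)
  qed
  have pure_P: "lookup (xp (single t (Suc x)) :: 'a mpoly) (P j) = 0" if j: "j \<in> V" and t: "t \<noteq> i0" for j t x
  proof -
    have "single t (Suc x) \<noteq> P j"
      using lkP[OF j, of i0] t by (metis lookup_single_not_eq nat.distinct(1))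
    then show ?thesis by (simp add: lookup_single)
  qed
  have ss: "single t (Suc x) = single s (Suc y) \<longleftrightarrow> t = s \<and> x = y" for t s x y :: nat
    by (auto simp: poly_mapping_eq_iff fun_eq_iff lookup_single when_def split: if_splits)
  have mat: "lookup (el t) (pt s) = (if t = s then 1 else 0)" if "t \<le> n" "s \<le> n" for t s
    using that j12 i0_less EP E_pure pure_P
    by (auto simp: el_def pt_def) (auto simp: lookup_single when_def ss)
  have "\<exists>c. (\<exists>t\<le>n. c t \<noteq> 0) \<and> (\<forall>s\<le>n. (\<Sum>t\<le>n. c t * lookup (el t) (pt s)) = 0)"
  proof (rule gen_ideal_relation)
    show "el t \<in> gen_ideal n n gs" if "t \<le> n" for t
      using that E j12 pure_power_Ann[of t] unfolding gen[symmetric] by (auto simp: el_def)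
    fix h s r assume h: "h \<in> gen_ideal n n gs" "s \<le> n" "r \<preceq> pt s" "r \<noteq> pt s"
    have hI: "h \<in> I" using h gen by simp
    consider "s = n" | "s \<noteq> n" "s = i0" | "s \<noteq> n" "s \<noteq> i0" by blast
    then show "lookup h r = 0"
    proof cases
      case 1
      then show ?thesis using P_van[OF j12(2,1) _ hI] j12 h by (auto simp: pt_def)
    next
      case 2
      then show ?thesis using P_van[OF j12 hI] h by (auto simp: pt_def)
    next
      case 3
      obtain i' where "i' \<in> V" "i' \<noteq> s" using j12 by metis
      moreover have "i0 \<in> U" using U_single by auto
      ultimately show ?thesis using pure_power_vanish[of i0 s i'] hI h 3 by (auto simp: pt_def)
    qed
  qed
  then obtain c where c: "\<exists>t\<le>n. c t \<noteq> 0" "\<And>s. s \<le> n \<Longrightarrow> (\<Sum>t\<le>n. c t * lookup (el t) (pt s)) = 0" by blast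
  have "c s = 0" if s: "s \<le> n" for s
  proof -
    have "(\<Sum>t\<le>n. c t * lookup (el t) (pt s)) = (\<Sum>t\<le>n. if t = s then c s else 0)"
      using s mat by (intro sum.cong) auto
    then show ?thesis using c(2)[OF s] s by simp
  qed
  then show False using c(1) by blast
qed

end


subsection \<open>Degeneration to a monomial\<close>

context binomial_dual_single
begin

definition linform :: "'a \<Rightarrow> 'a mpoly" where
  "linform \<tau> = (\<Sum>l<n. single (single l 1) (if l = i0 then \<tau> else 1))"

lemma linform_in_vars: "in_vars n (linform \<tau>)"
  unfolding linform_def by (intro in_vars_sum in_vars_single) auto

lemma linform_homog: "homog 1 (linform \<tau>)"
  unfolding linform_def by (intro homog_sum homog_single) auto

lemma linform_mult_xp:
  "h * (linform \<tau> * xp r) = (\<Sum>l<n. single 0 (if l = i0 then \<tau> else 1) * (h * xp (single l 1 + r)))"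
  unfolding linform_def
  by (simp add: sum_distrib_right sum_distrib_left mult_single mult.left_commute[of _ h])

text \<open>Scaling the variable \<open>i0\<close> by \<open>\<tau>\<close> multiplies coefficients
  by powers of \<open>\<tau>\<close>; the power for \<open>r\<close> stands on the left to avoid a
  subtraction of exponents.\<close>

lemma linform_scale:
  "\<tau> ^ lookup r i0 * lookup (linform \<tau> ^ m * xp r) p = \<tau> ^ lookup p i0 * lookup (linform 1 ^ m * xp r) p"
proof (induction m arbitrary: r)
  case 0
  show ?case by (auto simp: lookup_single when_def)
next
  case (Suc m)
  have "\<tau> ^ lookup r i0 * lookup (linform \<tau> ^ Suc m * xp r) p
      = (\<Sum>l<n. \<tau> ^ lookup (single l 1 + r) i0 * lookup (linform \<tau> ^ m * xp (single l 1 + r)) p)"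
    by (simp only: power_Suc2 mult.assoc linform_mult_xp lookup_sum lookup_smult sum_distrib_left)
      (auto intro!: sum.cong simp: lookup_add lookup_single when_def)
  also have "\<dots> = \<tau> ^ lookup p i0 * (\<Sum>l<n. lookup (linform 1 ^ m * xp (single l 1 + r)) p)"
    by (simp only: Suc sum_distrib_left)
  also have "(\<Sum>l<n. lookup (linform 1 ^ m * xp (single l 1 + r)) p) = lookup (linform 1 ^ Suc m * xp r) p"
    by (simp only: power_Suc2 mult.assoc linform_mult_xp lookup_sum lookup_smult if_cancel mult_1_left)
  finally show ?case .
qed

definition B :: "nat \<Rightarrow> (nat \<Rightarrow>\<^sub>0 nat) set" where "B k = {p. p \<preceq> b \<and> mdeg p = k}"

lemma finite_B: "finite (B k)"
  unfolding B_def using finite_mdvd[of b] by (rule rev_finite_subset) auto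

definition reducible :: "nat \<Rightarrow> 'a mpoly \<Rightarrow> bool" where
  "reducible k f \<longleftrightarrow> (\<exists>y. f - (\<Sum>p\<in>B k. single p (y p)) \<in> I)"

lemma reducible_Ann: "f \<in> I \<Longrightarrow> reducible k f"
  unfolding reducible_def by (intro exI[of _ "\<lambda>_. 0"]) simp

lemma reducible_diff:
  assumes "reducible k f" "reducible k h" shows "reducible k (f - h)"
proof -
  obtain y z where "f - (\<Sum>p\<in>B k. single p (y p)) \<in> I" "h - (\<Sum>p\<in>B k. single p (z p)) \<in> I"
    using assms by (auto simp: reducible_def)
  from Ann_diff[OF this] show ?thesis unfolding reducible_def
    by (intro exI[of _ "\<lambda>p. y p - z p"]) (simp add: single_diff sum_subtractf algebra_simps)
qed

lemma reducible_add:
  assumes "reducible k f" "reducible k h" shows "reducible k (f + h)"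
proof -
  have "reducible k (f - (0 - h))"
    by (intro reducible_diff assms reducible_Ann Ann_zero)
  then show ?thesis by simp
qed

lemma reducible_smult:
  assumes "reducible k f" shows "reducible k (single 0 c * f)"
proof -
  obtain y where "f - (\<Sum>p\<in>B k. single p (y p)) \<in> I" using assms by (auto simp: reducible_def)
  from Ann_mult[OF this, of "single 0 c"] show ?thesis unfolding reducible_def
    by (intro exI[of _ "\<lambda>p. c * y p"]) (simp add: right_diff_distrib sum_distrib_left mult_single)
qed

lemma reducible_sum: "(\<And>i. i \<in> A \<Longrightarrow> reducible k (f i)) \<Longrightarrow> reducible k (sum f A)"
  by (induction A rule: infinite_finite_induct) (auto intro: reducible_add reducible_Ann Ann_zero)

text \<open>Rewriting that lowers the exponent of \<open>i0\<close>. A monomial that does not divide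
  \<open>X\<^sup>b\<close> either exceeds \<open>b\<close>, hence also \<open>a\<close>, at another
  variable and lies in \<open>I\<close>, or it contains \<open>i0\<close> to the power
  \<open>g + 1\<close>, which the bare chain replaces by terms with less of
  \<open>i0\<close>.\<close>

lemma reducible_xp:
  assumes m: "m * u \<le> Suc g" and j: "lookup a j < lookup b j" "lookup a j < m * (lookup b j - lookup a j)"
    and p: "keys p \<subseteq> {..<n}" "mdeg p = k"
  shows "reducible k (xp p)"
  using p
proof (induction "lookup p i0" arbitrary: p rule: less_induct)
  case less
  have ji: "j \<noteq> i0" using j(1) a_i0 by auto
  show ?case
  proof (cases "p \<preceq> b")
    case True
    then have pB: "p \<in> B k" using less by (simp add: B_def)
    have "(\<Sum>q\<in>B k. single q (if q = p then 1 else 0 :: 'a)) = (\<Sum>q\<in>B k. if q = p then xp p else 0)"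
      by (intro sum.cong) auto
    then have "(\<Sum>q\<in>B k. single q (if q = p then 1 else 0 :: 'a)) = xp p"
      using pB finite_B by simp
    then show ?thesis unfolding reducible_def using Ann_zero
      by (intro exI[of _ "\<lambda>q. if q = p then 1 else 0"]) simp
  next
    case False
    then obtain i where i: "lookup b i < lookup p i" by (auto simp: mdvd_def not_le)
    show ?thesis
    proof (cases "i = i0")
      case False
      then have "lookup a i < lookup p i" using a_le_b[of i] i by simp
      then have "xp p \<in> I" using less i by (intro Ann_xp) (auto simp: mdvd_def not_le)
      then show ?thesis by (rule reducible_Ann)
    next
      case True
      define p' where "p' = p - single i0 (Suc g)"
      have pp: "p = p' + single i0 (Suc g)"
        unfolding p'_def using i True
        by (intro mdvd_add_diff[symmetric]) (auto simp: mdvd_def lookup_single when_def)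
      have keys_p': "lookup p' l = 0" if "\<not> l < n" for l
        using lookup_eq_0_if_not_key[OF less.prems(1) that] pp by (simp add: lookup_add)
      define f0 where "f0 = (\<Sum>k\<le>m. single (ps 0 k) ((- c1 / c2) ^ k))"
      have "f0 \<in> I" unfolding f0_def by (rule chain_Ann[OF _ _ m ji]) (use j in auto)
      have "in_vars n (xp p' :: 'a mpoly)"
        by (rule in_vars_single, rule keys_subset_if) (metis keys_p')
      then have f0I: "xp p' * f0 \<in> I" by (rule Ann_mult[OF \<open>f0 \<in> I\<close>])
      have ps0: "ps 0 0 = single i0 (Suc g)"
        by (intro poly_mapping_eqI) (simp add: lookup_ps lookup_single when_def)
      have split: "{..m} = insert 0 {1..m}" by auto
      have f0_eq: "xp p' * f0 = xp p + (\<Sum>k\<in>{1..m}. single 0 ((- c1 / c2) ^ k) * xp (p' + ps 0 k))"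
        unfolding f0_def split by (simp add: distrib_left sum_distrib_left mult_single ps0 pp)
      have red: "reducible k (\<Sum>k\<in>{1..m}. single 0 ((- c1 / c2) ^ k) * xp (p' + ps 0 k))"
      proof (intro reducible_sum reducible_smult)
        fix s assume s: "s \<in> {1..m}"
        have "mdeg (ps 0 t) = Suc g" if "t \<le> m" for t
          using that
        proof (induction t)
          case 0
          then show ?case by (simp add: ps0)
        next
          case (Suc t)
          have "ps 0 (Suc t) + a = ps 0 t + b"
            by (rule ps_step) (use mult_u_mono[OF Suc.prems m] in auto)
          then have "mdeg (ps 0 (Suc t)) + mdeg a = mdeg (ps 0 t) + mdeg b" by (metis mdeg_add)
          then show ?case using mdeg_eq Suc by simp
        qed
        then have md: "mdeg (p' + ps 0 s) = k"
          using s less.prems(2) pp by (simp add: mdeg_add)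
        have su: "0 < s * u" using s u_pos by simp
        have lt: "lookup (p' + ps 0 s) i0 < lookup p i0"
          unfolding pp lookup_add lookup_single_eq using su lookup_ps[of 0 s i0] by simp
        have "lookup (p' + ps 0 s) l = 0" if "\<not> l < n" for l
          using keys_p'[OF that] lookup_eq_0_if_not_key[OF keys_b that] i0_less that
          by (auto simp: lookup_add lookup_ps)
        then have "keys (p' + ps 0 s) \<subseteq> {..<n}" by (intro keys_subset_if) metis
        then show "reducible k (xp (p' + ps 0 s))" using md by (rule less.hyps[OF lt])
      qed
      show ?thesis
        using reducible_diff[OF reducible_Ann[OF f0I] red] unfolding f0_eq by (simp only: add_diff_cancel_right')
    qed
  qed
qed

text \<open>The form with coefficients \<open>y\<close> becomes a function on the box of
  \<open>b\<close>, on which \<open>shiftE\<close> is multiplication by \<open>linform 1\<close>, so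
  \<open>shiftE_power_inj\<close> applies. The value at \<open>b - p\<close> gives back the
  coefficient at \<open>p\<close>.\<close>

lemma monomial_nondegenerate:
  fixes y :: "(nat \<Rightarrow>\<^sub>0 nat) \<Rightarrow> 'a"
  assumes i: "2 * i \<le> d"
    and y: "\<And>q. q \<in> B i \<Longrightarrow> (\<Sum>p\<in>B i. lookup (linform 1 ^ (d - 2 * i) * xp (p + q)) b * y p) = 0"
  shows "\<forall>p\<in>B i. y p = 0"
proof -
  define m where "m = d - 2 * i"
  define \<phi> where "\<phi> f q = lookup (f * xp q) b" for f :: "'a mpoly" and q
  have E: "shiftE {..<n} (\<phi> f) = \<phi> (linform 1 * f)" for f
  proof
    fix q
    have "linform 1 * f * xp q = (\<Sum>l<n. f * xp (q + single l 1))"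
      using linform_mult_xp[of f 1 q] by (simp add: ac_simps)
    then show "shiftE {..<n} (\<phi> f) q = \<phi> (linform 1 * f) q"
      by (simp add: shiftE_def \<phi>_def lookup_sum)
  qed
  have Em: "(shiftE {..<n} ^^ k) (\<phi> f) = \<phi> (linform 1 ^ k * f)" for k f
    by (induction k) (auto simp: E mult.assoc)
  define f where "f = (\<Sum>p\<in>B i. single p (y p))"
  have lf: "lookup f p = (if p \<in> B i then y p else 0)" for p
    unfolding f_def lookup_sum using finite_B by (simp add: lookup_single when_def)
  have boxed: "boxed b i (\<phi> f)"
    unfolding boxed_def
  proof (intro allI impI)
    fix q assume nz: "\<phi> f q \<noteq> 0"
    then have qb: "q \<preceq> b" and "lookup f (b - q) \<noteq> 0" by (auto simp: \<phi>_def lookup_mult_xp split: if_splits)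
    then have "mdeg (b - q) = i" by (auto simp: lf B_def split: if_splits)
    then show "q \<preceq> b \<and> mdeg q + i = mdeg b" using qb mdvd_add_diff[OF qb] by (metis mdeg_add add.commute)
  qed
  have "(shiftE {..<n} ^^ m) (\<phi> f) q = 0" for q
  proof (rule ccontr)
    assume nz: "(shiftE {..<n} ^^ m) (\<phi> f) q \<noteq> 0"
    then have "q \<preceq> b \<and> mdeg q + (i + m) = mdeg b"
      using boxed_shiftE_power[OF boxed] unfolding boxed_def by blast
    then have q: "q \<in> B i" using i mdeg_eq by (auto simp: B_def m_def)
    have "linform 1 ^ m * f * xp q = (\<Sum>p\<in>B i. single 0 (y p) * (linform 1 ^ m * xp (p + q)))"
      unfolding f_def by (simp add: sum_distrib_left sum_distrib_right mult.assoc mult_single mult.left_commute[of "single 0 _"])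
    then have "(shiftE {..<n} ^^ m) (\<phi> f) q = (\<Sum>p\<in>B i. lookup (linform 1 ^ m * xp (p + q)) b * y p)"
      unfolding Em \<phi>_def by (simp add: lookup_sum lookup_smult mult.commute[of "y _"])
    then show False using nz y[OF q] by (simp add: m_def)
  qed
  then have "(shiftE {..<n} ^^ m) (\<phi> f) = (\<lambda>q. 0)" by blast
  then have \<phi>0: "\<phi> f = (\<lambda>q. 0)"
    using i mdeg_eq by (intro shiftE_power_inj[OF _ keys_b boxed]) (auto simp: m_def)
  show ?thesis
  proof
    fix p assume p: "p \<in> B i"
    have "b = p + (b - p)" using mdvd_add_diff[of p b] p by (simp add: B_def add.commute)
    then have "\<phi> f (b - p) = lookup f p" unfolding \<phi>_def by (metis lookup_mult_xp_add)
    then show "y p = 0" using \<phi>0 p lf by simp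
  qed
qed

text \<open>Rescaling the variable \<open>i0\<close> by \<open>\<tau>\<close> multiplies the contribution of \<open>X\<^sup>a\<close> to the Hessian by
  \<open>\<tau> ^ u\<close> relative to that of \<open>X\<^sup>b\<close>, and at \<open>0\<close> only the monomial \<open>X\<^sup>b\<close> remains.\<close>

lemma SLP_degeneration:
  assumes m: "m * u \<le> Suc g" and j: "lookup a j < lookup b j" "lookup a j < m * (lookup b j - lookup a j)"
  shows "SLP n I"
proof -
  let ?A = "\<lambda>i q p. c1 * lookup (linform 1 ^ (d - 2 * i) * xp (p + q)) a"
  let ?B = "\<lambda>i q p. c2 * lookup (linform 1 ^ (d - 2 * i) * xp (p + q)) b"
  define bad where "bad i = {e. \<exists>y. (\<exists>p\<in>B i. y p \<noteq> 0) \<and>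
    (\<forall>q\<in>B i. (\<Sum>p\<in>B i. (?B i q p + e * ?A i q p) * y p) = 0)}" for i
  have "finite (bad i)" if i: "2 * i \<le> d" for i
    unfolding bad_def
  proof (rule finite_singular_pencil[OF finite_B])
    fix y assume y: "\<And>q. q \<in> B i \<Longrightarrow> (\<Sum>p\<in>B i. ?B i q p * y p) = 0"
    show "\<forall>p\<in>B i. y p = 0"
    proof (rule monomial_nondegenerate[OF i])
      fix q assume "q \<in> B i"
      then have "c2 * (\<Sum>p\<in>B i. lookup (linform 1 ^ (d - 2 * i) * xp (p + q)) b * y p) = 0"
        using y by (simp add: sum_distrib_left mult.assoc)
      then show "(\<Sum>p\<in>B i. lookup (linform 1 ^ (d - 2 * i) * xp (p + q)) b * y p) = 0"
        using c2 by simp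
    qed
  qed
  then have finbad: "finite (\<Union>i\<in>{i. 2 * i \<le> d}. bad i)"
    by (intro finite_UN_I) (auto intro: finite_subset[of _ "{..d}"])
  \<comment> \<open>Distinct positive integers have distinct \<open>u\<close>-th powers, so some
    \<open>\<tau> ^ u\<close> avoids the finitely many bad parameters.\<close>
  have "inj (\<lambda>k::nat. (of_nat (Suc k) :: 'a) ^ u)"
  proof (rule injI)
    fix k l :: nat assume "(of_nat (Suc k) :: 'a) ^ u = of_nat (Suc l) ^ u"
    then have "(of_nat (Suc k ^ u) :: 'a) = of_nat (Suc l ^ u)" by (simp only: of_nat_power)
    then have "Suc k ^ u = Suc l ^ u" by (simp only: of_nat_eq_iff)
    then show "k = l" using u_pos power_eq_imp_eq_base[of "Suc k" u "Suc l"] by simp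
  qed
  then have "finite ((\<lambda>k::nat. (of_nat (Suc k) :: 'a) ^ u) -` (\<Union>i\<in>{i. 2 * i \<le> d}. bad i))"
    using finbad by (intro finite_vimageI)
  from ex_new_if_finite[OF infinite_UNIV_nat this]
  obtain k :: nat where k: "(of_nat (Suc k) :: 'a) ^ u \<notin> (\<Union>i\<in>{i. 2 * i \<le> d}. bad i)"
    unfolding vimage_eq ..
  define \<tau> :: 'a where "\<tau> = of_nat (Suc k)"
  have \<tau>0: "\<tau> \<noteq> 0" unfolding \<tau>_def by (simp only: of_nat_eq_0_iff)
  have \<tau>: "\<tau> ^ u \<notin> bad i" if "2 * i \<le> d" for i using k that by (simp add: \<tau>_def)
  show ?thesis
  proof (rule SLP_if_injective[OF linform_in_vars linform_homog])
    fix i f assume i: "2 * i \<le> d" and f: "in_vars n f" "homog i f" and Lf: "linform \<tau> ^ (d - 2 * i) * f \<in> I"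
    let ?L = "linform \<tau> ^ (d - 2 * i)"
    have "reducible i (\<Sum>p\<in>keys f. single 0 (lookup f p) * xp p)"
      using f by (intro reducible_sum reducible_smult reducible_xp[OF m j]) (auto simp: in_vars_def homog_def)
    then have "reducible i f" using mpoly_eq_sum_xp[of f] by simp
    then obtain y where y: "f - (\<Sum>p\<in>B i. single p (y p)) \<in> I" by (auto simp: reducible_def)
    define h where "h = (\<Sum>p\<in>B i. single p (y p))"
    have "?L * (f - h) \<in> I" using y unfolding h_def[symmetric] by (intro Ann_mult in_vars_power linform_in_vars)
    from Ann_diff[OF Lf this] have Lh: "?L * h \<in> I" by (simp add: right_diff_distrib)
    \<comment> \<open>After this rescaling the powers of \<open>\<tau>\<close> depend only on
      \<open>a\<close> and \<open>b\<close>. Cancelling the common \<open>\<tau> ^ g\<close> leaves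
      the pencil at the parameter \<open>\<tau> ^ u\<close>.\<close>
    define Y where "Y p = y p / \<tau> ^ lookup p i0" for p
    have Yp: "y p = Y p * \<tau> ^ lookup p i0" for p using \<tau>0 by (simp add: Y_def)
    have aux1: "s * (w * t * (c1 * x + c2 * z)) = w * (c1 * (t * s * x) + c2 * (t * s * z))"
      and aux2: "w * (c1 * (t * s * x) + c2 * (t * z)) = t * ((c2 * z + s * (c1 * x)) * w)"
      for s t w x z by (simp_all add: algebra_simps)
    have scale_a: "\<tau> ^ lookup r i0 * lookup (?L * xp r) a
        = \<tau> ^ g * \<tau> ^ u * lookup (linform 1 ^ (d - 2 * i) * xp r) a" for r
      unfolding linform_scale using arg_cong[OF a_i0, of "\<lambda>k. \<tau> ^ k"] by (simp only: power_add)
    have "(\<Sum>p\<in>B i. (?B i q p + \<tau> ^ u * ?A i q p) * Y p) = 0" for q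
    proof -
      have "?L * h * xp q = (\<Sum>p\<in>B i. single 0 (y p) * (?L * xp (p + q)))"
        unfolding h_def by (simp add: sum_distrib_left sum_distrib_right mult.assoc mult_single mult.left_commute[of "single 0 _"])
      then have "0 = (\<Sum>p\<in>B i. y p * \<Phi> (?L * xp (p + q)))"
        using \<Phi>_Ann[OF Lh, of "xp q"] by (simp add: \<Phi>_sum \<Phi>_smult)
      then have "0 = \<tau> ^ lookup q i0 * (\<Sum>p\<in>B i. y p * \<Phi> (?L * xp (p + q)))" by simp
      also have "\<dots> = (\<Sum>p\<in>B i. Y p * (c1 * (\<tau> ^ lookup (p + q) i0 * lookup (?L * xp (p + q)) a)
          + c2 * (\<tau> ^ lookup (p + q) i0 * lookup (?L * xp (p + q)) b)))"
        unfolding sum_distrib_left Yp \<Phi>_def lookup_add power_add by (intro sum.cong refl aux1)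
      also have "\<dots> = \<tau> ^ g * (\<Sum>p\<in>B i. (?B i q p + \<tau> ^ u * ?A i q p) * Y p)"
        unfolding scale_a linform_scale[of _ _ _ b] sum_distrib_left by (intro sum.cong refl aux2)
      finally have eq: "\<tau> ^ g * (\<Sum>p\<in>B i. (?B i q p + \<tau> ^ u * ?A i q p) * Y p) = 0" by (rule sym)
      have "\<tau> ^ g \<noteq> 0" using \<tau>0 by simp
      from mult_left_cancel[OF this, THEN iffD1] show ?thesis by this (simp only: eq mult_zero_right)
    qed
    then have "\<tau> ^ u \<in> bad i" if "p \<in> B i" "Y p \<noteq> 0" for p
      unfolding bad_def using that by (intro CollectI exI[of _ Y] conjI bexI[of _ p] ballI)
    then have "Y p = 0" if "p \<in> B i" for p using \<tau>[OF i] that by metis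
    then have "h = 0" unfolding h_def by (intro sum.neutral) (simp add: Yp)
    then show "f \<in> I" using y h_def by simp
  qed
qed

end


subsection \<open>Binomials differing in two variables only\<close>

locale binomial_dual_two = binomial_dual_single n a b c1 c2 i0
  for n a b and c1 c2 :: "'a::field_char_0" and i0 +
  fixes j0 :: nat
  assumes V_single: "{i. lookup a i < lookup b i} = {j0}"
begin

lemma j0_less: "j0 < n"
  using UV_vars(2)[of j0] V_single by blast

lemma j0_i0: "j0 \<noteq> i0" "i0 \<noteq> j0"
proof -
  have "lookup a j0 < lookup b j0" "lookup b i0 < lookup a i0" using U_single V_single by blast+
  then show "j0 \<noteq> i0" "i0 \<noteq> j0" by auto
qed

lemma rest_eq: "k \<noteq> i0 \<Longrightarrow> k \<noteq> j0 \<Longrightarrow> lookup b k = lookup a k"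
  using U_single V_single by (metis (mono_tags) linorder_neqE_nat mem_Collect_eq singletonD)

definition d0 :: nat where "d0 = lookup a i0 + lookup a j0"

definition rest :: "nat \<Rightarrow>\<^sub>0 nat" where "rest = a - single i0 (lookup a i0) - single j0 (lookup a j0)"

lemma lookup_rest: "lookup rest k = (if k = i0 \<or> k = j0 then 0 else lookup a k)"
  using j0_i0 by (auto simp: rest_def lookup_minus lookup_single when_def)

lemma a_split: "a = single i0 (lookup a i0) + single j0 (lookup a j0) + rest"
  using j0_i0 by (intro poly_mapping_eqI) (auto simp: lookup_add lookup_rest lookup_single when_def)

lemma d_split: "d = d0 + mdeg rest"
  by (subst a_split) (simp add: mdeg_add d0_def)

text \<open>The binary form of degree \<open>m\<close> whose dehomogenisation is \<open>h\<close>; coefficients of \<open>h\<close> above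
  \<open>m\<close> are dropped.\<close>

definition H :: "nat \<Rightarrow> 'a poly \<Rightarrow> 'a mpoly" where
  "H m h = (\<Sum>s\<le>m. single (single i0 s + single j0 (m - s)) (coeff h s))"

lemma H_add: "H m (p + q) = H m p + H m q"
  by (simp add: H_def single_add sum.distrib)

lemma H_diff: "H m (p - q) = H m p - H m q"
  by (simp add: H_def single_diff sum_subtractf)

lemma H_smult: "H m (smult c p) = single 0 c * H m p"
  by (simp add: H_def sum_distrib_left mult_single)

lemma H_zero: "H m 0 = 0"
  by (simp add: H_def)

lemma H_sum: "H m (sum f A) = (\<Sum>i\<in>A. H m (f i))"
  by (induction A rule: infinite_finite_induct) (auto simp: H_add H_zero)

lemma H_homog: "homog m (H m h)"
  unfolding H_def by (intro homog_sum homog_single) (simp add: mdeg_add)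

lemma H_in_vars: "in_vars n (H m h)"
  unfolding H_def
proof (intro in_vars_sum in_vars_single keys_subset_if)
  fix s j assume "lookup (single i0 s + single j0 (m - s)) j \<noteq> 0"
  then show "j < n" using i0_less j0_less by (auto simp: lookup_add lookup_single when_def split: if_splits)
qed

lemma lookup_H: "lookup (H m h) p \<noteq> 0 \<Longrightarrow> k \<noteq> i0 \<Longrightarrow> k \<noteq> j0 \<Longrightarrow> lookup p k = 0"
proof -
  assume h: "lookup (H m h) p \<noteq> 0" "k \<noteq> i0" "k \<noteq> j0"
  then obtain s where "lookup (single (single i0 s + single j0 (m - s)) (coeff h s)) p \<noteq> 0"
    unfolding H_def lookup_sum by (meson sum.neutral)
  then have "p = single i0 s + single j0 (m - s)" by (auto simp: lookup_single when_def split: if_splits)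
  then show "lookup p k = 0" using h by (simp add: lookup_add lookup_single)
qed

lemma H_monom: "s \<le> m \<Longrightarrow> H m (monom 1 s) = xp (single i0 s + single j0 (m - s))"
proof -
  assume s: "s \<le> m"
  have "H m (monom 1 s) = (\<Sum>t\<le>m. if t = s then xp (single i0 s + single j0 (m - s)) else 0)"
    unfolding H_def by (intro sum.cong) auto
  then show ?thesis using s by simp
qed

text \<open>The form whose dehomogenisation is \<open>[:-x, 1:]\<close>.\<close>

definition lin :: "'a \<Rightarrow> 'a mpoly" where
  "lin x = xp (single i0 1) - single (single j0 1) x"

lemma lin_in_vars: "in_vars n (lin x)"
  unfolding lin_def using i0_less j0_less by (intro in_vars_minus in_vars_single) auto

lemma lin_homog: "homog 1 (lin x)"
  unfolding lin_def by (intro homog_minus homog_single) auto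

lemma H_lin:
  assumes "degree h \<le> m" shows "H (Suc m) ([:-x, 1:] * h) = lin x * H m h"
proof -
  have 1: "H (Suc m) (pCons 0 h) = xp (single i0 1) * H m h"
    unfolding H_def sum.atMost_Suc_shift
    by (simp add: sum_distrib_left mult_single single_add[symmetric] add.assoc[symmetric] del: sum.atMost_Suc)
  have "H (Suc m) h = (\<Sum>s\<le>m. single (single i0 s + single j0 (Suc m - s)) (coeff h s))"
    unfolding H_def using assms by (simp add: coeff_eq_0)
  also have "\<dots> = xp (single j0 1) * H m h"
    unfolding H_def sum_distrib_left
  proof (rule sum.cong[OF refl])
    fix s assume "s \<in> {..m}"
    then have "single j0 (Suc m - s) = single j0 1 + single j0 (m - s)"
      by (simp add: single_add[symmetric] Suc_diff_le)
    then show "single (single i0 s + single j0 (Suc m - s)) (coeff h s) =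
        xp (single j0 1) * single (single i0 s + single j0 (m - s)) (coeff h s)"
      by (simp add: mult_single ac_simps)
  qed
  finally have 2: "H (Suc m) h = xp (single j0 1) * H m h" .
  have "[:-x, 1:] * h = pCons 0 h - smult x h" by (simp add: algebra_simps)
  moreover have "single (single j0 1) x = single 0 x * xp (single j0 1)" by (simp add: mult_single)
  ultimately show ?thesis by (simp only: H_diff H_smult 1 2 lin_def left_diff_distrib mult.assoc)
qed

lemma degree_lin_power_mult: "degree h \<le> m \<Longrightarrow> degree ([:-x, 1:] ^ k * h) \<le> m + k"
  using degree_mult_le[of "[:-x, 1:] ^ k" h] by (simp add: degree_linear_power)

lemma H_lin_power: "degree h \<le> m \<Longrightarrow> H (m + k) ([:-x, 1:] ^ k * h) = lin x ^ k * H m h"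
proof (induction k)
  case (Suc k)
  have "H (m + Suc k) ([:-x, 1:] ^ Suc k * h) = H (Suc (m + k)) ([:-x, 1:] * ([:-x, 1:] ^ k * h))"
    by (simp only: power_Suc mult.assoc add_Suc_right)
  also have "\<dots> = lin x * H (m + k) ([:-x, 1:] ^ k * h)"
    by (rule H_lin[OF degree_lin_power_mult[OF Suc.prems]])
  finally show ?case using Suc by (simp add: mult.assoc)
qed simp

lemma \<Phi>_H:
  assumes "\<Phi> (H m h * xp q) \<noteq> 0" "k \<noteq> i0" "k \<noteq> j0"
  shows "lookup q k = lookup a k"
proof -
  have *: "lookup q k = lookup c k" if "lookup (H m h * xp q) c \<noteq> 0" for c
  proof -
    have q: "q \<preceq> c" "lookup (H m h) (c - q) \<noteq> 0" using that by (auto simp: lookup_mult_xp split: if_splits)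
    have "lookup c k - lookup q k = 0" using lookup_H[OF q(2) assms(2,3)] by (simp add: lookup_minus)
    moreover have "lookup q k \<le> lookup c k" using q(1) by (simp add: mdvd_def)
    ultimately show ?thesis by simp
  qed
  have "lookup (H m h * xp q) a \<noteq> 0 \<or> lookup (H m h * xp q) b \<noteq> 0"
    using assms(1) by (auto simp: \<Phi>_def)
  then show ?thesis using *[of a] *[of b] rest_eq[OF assms(2,3)] by auto
qed

text \<open>A binary form does not touch the other variables, in which \<open>a\<close> and
  \<open>b\<close> agree, so only multipliers containing exactly \<open>rest\<close> can pair
  nontrivially with it.\<close>

lemma H_AnnI:
  assumes "\<And>t. m \<le> d0 \<Longrightarrow> t \<le> d0 - m \<Longrightarrow> \<Phi> (H m h * xp (single i0 t + single j0 (d0 - m - t) + rest)) = 0"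
  shows "H m h \<in> I"
proof (rule Ann_homogI[OF H_in_vars H_homog], rule ccontr)
  fix q assume q: "mdeg q + m = d" and nz: "\<Phi> (H m h * xp q) \<noteq> 0"
  have qs: "q = single i0 (lookup q i0) + single j0 (lookup q j0) + rest"
    using j0_i0 \<Phi>_H[OF nz]
    by (intro poly_mapping_eqI) (auto simp: lookup_add lookup_rest lookup_single when_def)
  have "mdeg q = lookup q i0 + lookup q j0 + mdeg rest"
    by (subst qs) (simp add: mdeg_add)
  then have "lookup q i0 + lookup q j0 + m = d0" using q d_split by simp
  then have "m \<le> d0" "lookup q i0 \<le> d0 - m" "lookup q j0 = d0 - m - lookup q i0" by auto
  then show False using assms[of "lookup q i0"] nz qs by metis
qed

lemma H_Ann_above: "d0 < m \<Longrightarrow> H m h \<in> I"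
  by (rule H_AnnI) simp

text \<open>The annihilator contains at least \<open>d0 - 2 * i\<close> independent binary forms of degree
  \<open>d0 - i\<close>; for general \<open>x\<close> they span the forms of that degree modulo \<open>lin x ^ (d0 - 2 * i)\<close>.\<close>

lemma binary_SLP:
  assumes i: "2 * i \<le> d0"
  shows "\<exists>bad. finite bad \<and> (\<forall>x h. x \<notin> bad \<longrightarrow> degree h \<le> d0 - i \<longrightarrow>
    (\<exists>h'. degree h' \<le> i \<and> H (d0 - i) (h - [:-x, 1:] ^ (d0 - 2 * i) * h') \<in> I))"
proof -
  define m where "m = d0 - i"
  define psi where "psi t h = \<Phi> (H m h * xp (single i0 t + single j0 (i - t) + rest))" for t h
  \<comment> \<open>There are \<open>m + 1\<close> coefficients and \<open>i + 1\<close> test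
    multipliers, so at least \<open>d0 - 2 * i\<close> independent forms remain.\<close>
  have "\<exists>J e. J \<subseteq> {..m} \<and> card {..m} \<le> card J + card {..i} \<and> poly_indep J e \<and>
    (\<forall>j\<in>J. degree (e j) \<le> m \<and> (\<forall>t\<in>{..i}. psi t (e j) = 0))"
  proof (rule poly_indep_kernels[OF _ _ poly_indep_monom])
    show "psi t (p + q) = psi t p + psi t q" for t p q
      by (simp add: psi_def H_add \<Phi>_add distrib_right)
    show "psi t (smult c p) = c * psi t p" for t c p
      by (simp add: psi_def H_smult \<Phi>_smult mult.assoc)
    show "degree p \<le> m \<Longrightarrow> degree q \<le> m \<Longrightarrow> degree (p + q) \<le> m" for p q :: "'a poly"
      by (rule degree_add_le)
  qed (auto simp: degree_monom_eq intro: order_trans[OF degree_smult_le])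
  then obtain J0 e where J0: "J0 \<subseteq> {..m}" "card {..m} \<le> card J0 + card {..i}" "poly_indep J0 e"
    and e: "\<And>j. j \<in> J0 \<Longrightarrow> degree (e j) \<le> m \<and> (\<forall>t\<le>i. psi t (e j) = 0)" by auto
  have "d0 - 2 * i \<le> card J0" using J0(2) i by (simp add: m_def)
  then obtain J where J: "J \<subseteq> J0" "card J = d0 - 2 * i" using obtain_subset_with_card_n by metis
  have finJ: "finite J0" "finite J" using J0(1) J(1) by (meson finite_subset finite_atMost)+
  have indJ: "poly_indep J e" by (rule poly_indep_subset[OF J0(3) J(1) finJ(1)])
  have eI: "H m (e j) \<in> I" if "j \<in> J" for j
  proof (rule H_AnnI)
    fix t assume "m \<le> d0" "t \<le> d0 - m"
    moreover have "d0 - m = i" using i by (simp add: m_def)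
    ultimately show "\<Phi> (H m (e j) * xp (single i0 t + single j0 (d0 - m - t) + rest)) = 0"
      using e that J(1) by (auto simp: psi_def)
  qed
  let ?bad = "{x. \<exists>c. (\<exists>i\<in>J. c i \<noteq> 0) \<and> [:-x, 1:] ^ card J dvd (\<Sum>i\<in>J. smult (c i) (e i))}"
  have "\<exists>h'. degree h' \<le> i \<and> H m (h - [:-x, 1:] ^ (d0 - 2 * i) * h') \<in> I"
    if x: "x \<notin> ?bad" and h: "degree h \<le> m" for x h
  proof -
    obtain c where "[:-x, 1:] ^ card J dvd h - (\<Sum>i\<in>J. smult (c i) (e i))"
      using solve_mod_power[OF finJ(2), of x e h] x by blast
    then obtain h' where h': "h - (\<Sum>i\<in>J. smult (c i) (e i)) = [:-x, 1:] ^ (d0 - 2 * i) * h'"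
      unfolding J(2) by (auto simp: dvd_def)
    have "degree (\<Sum>i\<in>J. smult (c i) (e i)) \<le> m"
      using e J(1) by (intro degree_sum_le finJ) (auto intro: order_trans[OF degree_smult_le])
    then have "degree ([:-x, 1:] ^ (d0 - 2 * i) * h') \<le> m"
      unfolding h'[symmetric] using h by (intro degree_diff_le)
    then have "degree h' \<le> i"
      using i by (cases "h' = 0") (auto simp: degree_mult_eq degree_linear_power m_def)
    moreover have "h - [:-x, 1:] ^ (d0 - 2 * i) * h' = (\<Sum>i\<in>J. smult (c i) (e i))"
      unfolding h'[symmetric] by simp
    then have "H m (h - [:-x, 1:] ^ (d0 - 2 * i) * h') \<in> I"
      by (simp only: H_sum H_smult) (intro Ann_sum Ann_mult eI, auto)
    ultimately show ?thesis by blast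
  qed
  moreover have "finite ?bad" by (rule finite_high_order_vanishing[OF finJ(2) indJ])
  ultimately show ?thesis unfolding m_def by blast
qed

text \<open>The algebra is the tensor product of the binary part with a monomial complete
  intersection. A primitive element \<open>w\<close> of degree \<open>m\<close> of the binary part generates, under \<open>lin x\<close>,
  a string of length \<open>d0 - 2 * m + 1\<close>, so it behaves like a single variable \<open>i0\<close> with that truncation,
  and the functional \<open>\<psi> x (f * w)\<close> is again of monomial type.\<close>

definition linform2 :: "'a \<Rightarrow> 'a mpoly" where
  "linform2 x = lin x + (\<Sum>k\<in>{..<n} - {i0, j0}. xp (single k 1))"

text \<open>The exponent of \<open>i0\<close> counts powers of \<open>lin x\<close>, and
  \<open>j0\<close> carries no exponent, because one string stands for both binary
  variables.\<close>

definition \<psi> :: "'a \<Rightarrow> 'a mpoly \<Rightarrow> (nat \<Rightarrow>\<^sub>0 nat) \<Rightarrow> 'a" where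
  "\<psi> x w p = (if lookup p j0 = 0 then \<Phi> (w * lin x ^ lookup p i0 * xp (p - single i0 (lookup p i0))) else 0)"

lemma shiftE_\<psi>: "shiftE ({..<n} - {j0}) (\<psi> x w) = \<psi> x (linform2 x * w)"
proof
  fix p
  show "shiftE ({..<n} - {j0}) (\<psi> x w) p = \<psi> x (linform2 x * w) p"
  proof (cases "lookup p j0 = 0")
    case False
    then show ?thesis by (simp add: shiftE_def \<psi>_def lookup_add)
  next
    case True
    let ?r = "p - single i0 (lookup p i0)"
    let ?w = "w * lin x ^ lookup p i0"
    have N: "{..<n} - {j0} = insert i0 ({..<n} - {i0, j0})" using i0_less j0_i0 by auto
    have 1: "\<psi> x w (p + single i0 1) = \<Phi> (lin x * (?w * xp ?r))"
    proof -
      have "p + single i0 1 - single i0 (Suc (lookup p i0)) = ?r"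
        by (intro poly_mapping_eqI) (auto simp: lookup_add lookup_minus lookup_single when_def)
      then show ?thesis using True j0_i0 by (simp add: \<psi>_def lookup_add lookup_single ac_simps)
    qed
    have 2: "\<psi> x w (p + single k 1) = \<Phi> (xp (single k 1) * (?w * xp ?r))" if k: "k \<in> {..<n} - {i0, j0}" for k
    proof -
      have "p + single k 1 - single i0 (lookup p i0) = single k 1 + ?r"
        using k by (intro poly_mapping_eqI) (auto simp: lookup_add lookup_minus lookup_single when_def)
      moreover have "xp (single k 1 + ?r) = xp (single k 1) * (xp ?r :: 'a mpoly)"
        by (simp add: mult_single)
      ultimately show ?thesis using True k by (simp add: \<psi>_def lookup_add lookup_single ac_simps)
    qed
    have "shiftE ({..<n} - {j0}) (\<psi> x w) p = \<psi> x w (p + single i0 1) + (\<Sum>k\<in>{..<n} - {i0, j0}. \<psi> x w (p + single k 1))"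
      unfolding shiftE_def N by simp
    also have "\<dots> = \<Phi> (linform2 x * (?w * xp ?r))"
      unfolding linform2_def distrib_right sum_distrib_right \<Phi>_add \<Phi>_sum 1 using 2 by simp
    also have "\<dots> = \<psi> x (linform2 x * w) p" using True by (simp add: \<psi>_def mult.assoc)
    finally show ?thesis .
  qed
qed

lemma shiftE_power_\<psi>: "(shiftE ({..<n} - {j0}) ^^ k) (\<psi> x w) = \<psi> x (linform2 x ^ k * w)"
  by (induction k) (auto simp: shiftE_\<psi> mult.assoc)

text \<open>The function lives in the box of \<open>\<beta>\<close>, of degree
  \<open>d - 2 * m\<close>, and has degree \<open>i - m\<close> there. The middle power for these
  data is again \<open>d - 2 * i\<close>, as \<open>shiftE_power_inj\<close> requires.\<close>

lemma \<psi>_primitive_eq_0: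
  assumes f: "homog i f" "2 * i \<le> d" and Lf: "linform2 x ^ (d - 2 * i) * f \<in> I"
    and w: "homog m w" "2 * m \<le> d0" and prim: "lin x ^ (d0 - 2 * m + 1) * w \<in> I"
  shows "\<psi> x (f * w) = (\<lambda>p. 0)"
proof -
  define \<beta> where "\<beta> = single i0 (d0 - 2 * m) + rest"
  have md\<beta>: "mdeg \<beta> = d - 2 * m" using d_split w(2) by (simp add: \<beta>_def mdeg_add)
  have supp: "p \<preceq> \<beta> \<and> mdeg p + i + m = d" if nz: "\<psi> x (f * w) p \<noteq> 0" for p
  proof -
    let ?r = "p - single i0 (lookup p i0)"
    have pj: "lookup p j0 = 0" and nz': "\<Phi> (f * w * lin x ^ lookup p i0 * xp ?r) \<noteq> 0"
      using nz by (auto simp: \<psi>_def split: if_splits)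
    \<comment> \<open>Primitivity truncates the string: a larger exponent would produce a multiple
      of an annihilator element.\<close>
    have pi: "lookup p i0 \<le> d0 - 2 * m"
    proof (rule ccontr)
      assume "\<not> ?thesis"
      then have pw: "lin x ^ lookup p i0 = lin x ^ (d0 - 2 * m + 1) * lin x ^ (lookup p i0 - (d0 - 2 * m + 1))"
        by (simp add: power_add[symmetric] del: power_Suc)
      have "f * w * lin x ^ lookup p i0 * xp ?r
        = lin x ^ (d0 - 2 * m + 1) * w * (f * lin x ^ (lookup p i0 - (d0 - 2 * m + 1)) * xp ?r)"
        unfolding pw by (simp only: ac_simps)
      then show False using nz' \<Phi>_Ann[OF prim] by metis
    qed
    have "?r \<preceq> a \<or> ?r \<preceq> b" using nz' \<Phi>_not_mdvd by blast
    then have pk: "lookup p k \<le> lookup a k" if "k \<noteq> i0" "k \<noteq> j0" for k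
      using that rest_eq[OF that] by (auto simp: mdvd_def lookup_minus lookup_single when_def dest!: spec[of _ k])
    have "p \<preceq> \<beta>" unfolding mdvd_def
    proof
      fix k show "lookup p k \<le> lookup \<beta> k"
        using pi pj pk[of k] j0_i0 by (auto simp: \<beta>_def lookup_add lookup_rest lookup_single when_def)
    qed
    moreover have "single i0 (lookup p i0) \<preceq> p" by (auto simp: mdvd_def lookup_single when_def)
    then have "mdeg p = mdeg ?r + lookup p i0" by (metis mdvd_add_diff mdeg_add mdeg_single)
    moreover have "homog (i + m + 1 * lookup p i0 + mdeg ?r) (f * w * lin x ^ lookup p i0 * xp ?r)"
      by (intro homog_mult f w homog_power lin_homog homog_single refl)
    then have "i + m + lookup p i0 + mdeg ?r = d" using nz' \<Phi>_homog by fastforce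
    ultimately show ?thesis by simp
  qed
  show ?thesis
  proof (cases "m \<le> i")
    \<comment> \<open>For \<open>i < m\<close> the support would lie in a degree above that of
      \<open>\<beta>\<close>.\<close>
    case False
    have "\<psi> x (f * w) p = 0" for p
      using supp[of p] mdvd_mdeg[of p \<beta>] md\<beta> False w(2) d_split by force
    then show ?thesis by blast
  next
    case True
    have "boxed \<beta> (i - m) (\<psi> x (f * w))"
      unfolding boxed_def using supp md\<beta> True w(2) d_split by force
    moreover have "keys \<beta> \<subseteq> {..<n} - {j0}"
    proof
      fix k assume "k \<in> keys \<beta>"
      then have "lookup \<beta> k \<noteq> 0" by (simp add: in_keys_iff)
      then have "k = i0 \<or> (k \<noteq> j0 \<and> lookup a k \<noteq> 0)"
        by (auto simp: \<beta>_def lookup_add lookup_rest lookup_single when_def split: if_splits)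
      then show "k \<in> {..<n} - {j0}" 
        using i0_less j0_i0 lookup_eq_0_if_not_key[OF keys_a, of k] by (cases "k < n") auto
    qed
    moreover have "\<psi> x (linform2 x ^ (d - 2 * i) * (f * w)) = (\<lambda>p. 0)"
    proof
      fix p
      show "\<psi> x (linform2 x ^ (d - 2 * i) * (f * w)) p = 0"
        using \<Phi>_Ann[OF Lf] by (simp add: \<psi>_def mult.assoc)
    qed
    then have "(shiftE ({..<n} - {j0}) ^^ (d - 2 * i)) (\<psi> x (f * w)) = (\<lambda>p. 0)"
      by (simp only: shiftE_power_\<psi>)
    moreover have "d - 2 * i + 2 * (i - m) \<le> mdeg \<beta>"
      using f(2) True md\<beta> w(2) d_split by simp
    ultimately show ?thesis using shiftE_power_inj[of "{..<n} - {j0}"] by blast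
  qed
qed

lemma SLP_two: "SLP n I"
proof -
  have "\<forall>i\<in>{i. 2 * i \<le> d0}. \<exists>bad. finite bad \<and> (\<forall>x h. x \<notin> bad \<longrightarrow> degree h \<le> d0 - i \<longrightarrow>
    (\<exists>h'. degree h' \<le> i \<and> H (d0 - i) (h - [:-x, 1:] ^ (d0 - 2 * i) * h') \<in> I))"
    using binary_SLP by simp
  then obtain bad where bad: "\<forall>i\<in>{i. 2 * i \<le> d0}. finite (bad i) \<and> (\<forall>x h. x \<notin> bad i \<longrightarrow> degree h \<le> d0 - i \<longrightarrow>
    (\<exists>h'. degree h' \<le> i \<and> H (d0 - i) (h - [:-x, 1:] ^ (d0 - 2 * i) * h') \<in> I))"
    by (rule bchoice[THEN exE])
  have "finite (\<Union>i\<in>{i. 2 * i \<le> d0}. bad i)"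
    using bad by (intro finite_UN_I) (auto intro: finite_subset[of _ "{..d0}"])
  then obtain x :: 'a where x: "x \<notin> (\<Union>i\<in>{i. 2 * i \<le> d0}. bad i)"
    using ex_new_if_finite[OF infinite_UNIV_char_0] by blast
  have surj: "\<exists>h'. degree h' \<le> i \<and> H (d0 - i) (h - [:-x, 1:] ^ (d0 - 2 * i) * h') \<in> I"
    if "2 * i \<le> d0" "degree h \<le> d0 - i" for i h using bad x that by blast
  show ?thesis
  proof (rule SLP_if_injective)
    show "in_vars n (linform2 x)"
      unfolding linform2_def by (intro in_vars_add in_vars_sum lin_in_vars in_vars_single) auto
    show "homog 1 (linform2 x)"
      unfolding linform2_def by (intro homog_add homog_sum lin_homog homog_single) auto
    fix i f assume i: "2 * i \<le> d" and f: "in_vars n f" "homog i f"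
      and Lf: "linform2 x ^ (d - 2 * i) * f \<in> I"
    \<comment> \<open>\<open>f\<close> is orthogonal to everything that \<open>w\<close> generates
      under \<open>lin x\<close> and the non-binary variables. Proving this for all binary forms
      suffices, since every monomial is a binary one times a non-binary one.\<close>
    define Z where "Z w \<longleftrightarrow> (\<forall>s q. lookup q i0 = 0 \<longrightarrow> lookup q j0 = 0 \<longrightarrow> \<Phi> (f * w * lin x ^ s * xp q) = 0)" for w
    have Z_prim: "Z (H m h)" if "2 * m \<le> d0" "lin x ^ (d0 - 2 * m + 1) * H m h \<in> I" for m h
      unfolding Z_def
    proof (intro allI impI)
      fix s and q :: "nat \<Rightarrow>\<^sub>0 nat" assume q: "lookup q i0 = 0" "lookup q j0 = 0"
      have "\<psi> x (f * H m h) (single i0 s + q) = 0"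
        using \<psi>_primitive_eq_0[OF f(2) i Lf H_homog that] by simp
      then show "\<Phi> (f * H m h * lin x ^ s * xp q) = 0"
        using q j0_i0 by (simp add: \<psi>_def lookup_add lookup_single)
    qed
    have Z_add: "Z (v + w)" if "Z v" "Z w" for v w
      using that unfolding Z_def by (simp add: distrib_left distrib_right \<Phi>_add)
    have Z_lin: "Z (lin x ^ k * w)" if "Z w" for k w
      unfolding Z_def
    proof (intro allI impI)
      fix s and q :: "nat \<Rightarrow>\<^sub>0 nat" assume "lookup q i0 = 0" "lookup q j0 = 0"
      then have "\<Phi> (f * w * lin x ^ (k + s) * xp q) = 0" using that unfolding Z_def by blast
      then show "\<Phi> (f * (lin x ^ k * w) * lin x ^ s * xp q) = 0"
        by (simp add: power_add ac_simps)
    qed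
    have Z_Ann: "Z w" if "w \<in> I" for w
      using \<Phi>_Ann[OF that] unfolding Z_def by (simp add: mult.assoc mult.left_commute[of f w])
    have Z_low: "Z (H m h)" if "2 * m \<le> d0" "degree h \<le> m" for m h
      using that
    proof (induction m arbitrary: h)
      case 0
      have "lin x ^ (d0 + 1) * H 0 h = H (0 + (d0 + 1)) ([:-x, 1:] ^ (d0 + 1) * h)"
        by (rule H_lin_power[symmetric]) (use 0 in simp)
      also have "\<dots> \<in> I" by (rule H_Ann_above) simp
      finally show ?case using Z_prim[of 0 h] by simp
    next
      case (Suc m)
      let ?k = "d0 - 2 * Suc m + 1"
      obtain e where "d0 = 2 * Suc m + e" using Suc.prems(1) le_Suc_ex by blast
      then have k: "Suc m + ?k = d0 - m" "d0 - 2 * m = Suc ?k" by simp_all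
      have "degree ([:-x, 1:] ^ ?k * h) \<le> d0 - m"
        using degree_lin_power_mult[OF Suc.prems(2), of x ?k] unfolding k(1) .
      moreover have m2: "2 * m \<le> d0" using Suc.prems(1) by simp
      ultimately obtain h' where h': "degree h' \<le> m" "H (d0 - m) ([:-x, 1:] ^ ?k * h - [:-x, 1:] ^ (d0 - 2 * m) * h') \<in> I"
        using surj by blast
      \<comment> \<open>\<open>?k\<close> is the power that defines primitivity in degree
        \<open>Suc m\<close>. By the choice of \<open>h'\<close>, subtracting \<open>lin x\<close>
        times it from \<open>h\<close> leaves a primitive element, so \<open>h\<close> is primitive
        plus \<open>lin x\<close> times a form of lower degree.\<close>
      define h2 where "h2 = h - [:-x, 1:] * h'"
      have d1: "degree ([:-x, 1:] * h') \<le> Suc m" using degree_lin_power_mult[OF h'(1), of x 1] by simp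
      then have d2: "degree h2 \<le> Suc m" unfolding h2_def using Suc.prems(2) by (intro degree_diff_le)
      have "[:-x, 1:] ^ ?k * h - [:-x, 1:] ^ (d0 - 2 * m) * h' = [:-x, 1:] ^ ?k * h2"
        unfolding k(2) h2_def by (simp only: power_Suc2 mult.assoc right_diff_distrib)
      then have "H (Suc m + ?k) ([:-x, 1:] ^ ?k * h2) \<in> I" using h'(2) by (simp only: k(1))
      then have "lin x ^ ?k * H (Suc m) h2 \<in> I" by (simp only: H_lin_power[OF d2])
      then have "Z (H (Suc m) h2)" using Z_prim Suc.prems(1) by blast
      moreover have "Z (lin x ^ 1 * H m h')" by (intro Z_lin Suc.IH m2 h'(1))
      ultimately have "Z (H (Suc m) h2 + lin x ^ 1 * H m h')" by (rule Z_add)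
      moreover have "H (Suc m) h2 + lin x ^ 1 * H m h' = H (Suc m) h"
        using H_lin[OF h'(1), of x] by (simp add: h2_def H_diff)
      ultimately show ?case by simp
    qed
    have Z_all: "Z (H m h)" if h: "degree h \<le> m" for m h
    proof -
      consider "2 * m \<le> d0" | "d0 < 2 * m" "m \<le> d0" | "d0 < m" by linarith
      then show ?thesis
      proof cases
        case 1
        then show ?thesis using Z_low h by blast
      next
        case 2
        \<comment> \<open>Above the middle degree, surjectivity writes \<open>h\<close> modulo
          \<open>I\<close> as a power of \<open>lin x\<close> times a form of degree
          \<open>d0 - m\<close>.\<close>
        have e: "d0 - (d0 - m) = m" "d0 - 2 * (d0 - m) = 2 * m - d0" "d0 - m + (2 * m - d0) = m" using 2 by auto
        have m2: "2 * (d0 - m) \<le> d0" using 2 by simp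
        obtain h' where h': "degree h' \<le> d0 - m" "H m (h - [:-x, 1:] ^ (2 * m - d0) * h') \<in> I"
          using surj[OF m2, of h, unfolded e] h by blast
        have "H m ([:-x, 1:] ^ (2 * m - d0) * h') = lin x ^ (2 * m - d0) * H (d0 - m) h'"
          using H_lin_power[OF h'(1), of "2 * m - d0" x] unfolding e .
        moreover have "Z (lin x ^ (2 * m - d0) * H (d0 - m) h')"
          by (intro Z_lin Z_low m2 h'(1))
        moreover have "H m h = H m (h - [:-x, 1:] ^ (2 * m - d0) * h') + H m ([:-x, 1:] ^ (2 * m - d0) * h')"
          by (simp add: H_diff)
        ultimately show ?thesis using Z_add[OF Z_Ann[OF h'(2)]] by simp
      next
        case 3
        then show ?thesis using Z_Ann H_Ann_above by blast
      qed
    qed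
    show "f \<in> I"
      unfolding Ann_iff
    proof (intro conjI allI f)
      fix q :: "nat \<Rightarrow>\<^sub>0 nat"
      define s t where "s = lookup q i0" and "t = lookup q j0"
      define q' where "q' = q - single i0 s - single j0 t"
      have q': "lookup q' i0 = 0" "lookup q' j0 = 0"
        using j0_i0 by (auto simp: q'_def s_def t_def lookup_minus lookup_single)
      have "q = single i0 s + single j0 t + q'"
        using j0_i0 by (intro poly_mapping_eqI) (auto simp: q'_def s_def t_def lookup_add lookup_minus lookup_single when_def)
      moreover have "H (s + t) (monom 1 s) = xp (single i0 s + single j0 t)" by (simp add: H_monom)
      ultimately have "xp q = H (s + t) (monom 1 s) * xp q'" by (simp add: mult_single)
      moreover have "Z (H (s + t) (monom 1 s))" by (rule Z_all) (simp add: degree_monom_eq)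
      then have "\<Phi> (f * H (s + t) (monom 1 s) * lin x ^ 0 * xp q') = 0" using q' unfolding Z_def by blast
      ultimately show "\<Phi> (f * xp q) = 0" by (simp add: mult.assoc)
    qed
  qed
qed

end


section \<open>Assembly of the cases\<close>

context binomial_dual_single
begin

lemma SLP_if_CI:
  assumes gen: "I = gen_ideal n n gs"
  shows "SLP n I"
proof (cases "\<exists>j. V = {j}")
  case True
  then obtain j0 where "V = {j0}" by blast
  then interpret binomial_dual_two n a b c1 c2 i0 j0 by unfold_locales
  show ?thesis by (rule SLP_two)
next
  case False
  obtain j1 where j1: "j1 \<in> V" using V_nonempty by blast
  then obtain j2 where "j2 \<in> V" "j1 \<noteq> j2" using False by blast
  then obtain m j where "j \<in> V" "m * u \<le> Suc g" "lookup a j < m * (lookup b j - lookup a j)"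
    using short_chain_if_CI[OF gen j1] by blast
  then show ?thesis using SLP_degeneration by blast
qed

end

theorem theorem4p5:
  fixes F :: "'a::{alg_closed_field, field_char_0} mpoly" and n :: nat
  assumes "homog_binomial n F"
    and "artinian_CI n (Ann n F)"
  shows "SLP n (Ann n F)"
proof -
  obtain a b c1 c2 where *: "a \<noteq> b" "c1 \<noteq> 0" "c2 \<noteq> 0" "keys a \<subseteq> {..<n}" "keys b \<subseteq> {..<n}"
    "mdeg a = mdeg b" and F: "F = single a c1 + single b c2"
    using assms(1) unfolding homog_binomial_def by blast
  obtain g where gen: "Ann n F = gen_ideal n n g" using assms(2) by (auto simp: artinian_CI_def)
  interpret B: binomial_dual n a b c1 c2 by unfold_locales (use * in auto)
  \<comment> \<open>The same binomial with its monomials exchanged, so that \<open>V\<close> takes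
    the role of \<open>U\<close>.\<close>
  interpret B': binomial_dual n b a c2 c1 by unfold_locales (use * in auto)
  have BF: "B.F = F" and BF': "B'.F = F" by (simp_all add: B.F_def B'.F_def F add.commute)
  consider (U) i where "B.U = {i}" | (V) i where "B'.U = {i}"
    | (two) "\<nexists>i. B.U = {i}" "\<nexists>i. B'.U = {i}" by blast
  then show ?thesis
  proof cases
    case (U i)
    then interpret binomial_dual_single n a b c1 c2 i by unfold_locales
    show ?thesis using SLP_if_CI[unfolded BF, OF gen] .
  next
    case (V i)
    then interpret binomial_dual_single n b a c2 c1 i by unfold_locales
    show ?thesis using SLP_if_CI[unfolded BF', OF gen] .
  next
    case two
    obtain i1 i2 where i: "i1 \<in> B.U" "i2 \<in> B.U" "i1 \<noteq> i2" using B.U_nonempty two(1) by blast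
    obtain j1 j2 where j: "j1 \<in> B.V" "j2 \<in> B.V" "j1 \<noteq> j2" using B.V_nonempty two(2) by blast
    show ?thesis using B.not_CI_if_two_two[OF i j, of g] gen BF by simp
  qed
qed

end
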